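(* Let $A\in\mathbb{C}^{n\times n}$ be self-adjoint with respect to the inner product $(x,y)_M=x^{H}My$ with distinct eigenvalues, and let $u\in\mathbb{C}^n$ have nonzero coefficients in the $M$-orthonormal eigenbasis of $A$. Let $m$ be fixed ($3\le m<n$). Let $s_1,\dots,s_{m-3}\in\mathbb{C}\cup\{\pm\infty\}$ be given poles, distinct from the eigenvalues of $A$, with denominator $q_{m-3}(\lambda)=\prod_{j:\,s_j\neq\pm\infty}(\lambda-s_j)$, and let $u_q=q_{m-3}(A)^{-1}u$. Let $U_{m-2}\in\mathbb{C}^{n\times(m-2)}$ be a given $M$-orthonormal basis of the rational Krylov subspace $\mathcal{Q}_{m-2}(A,u)=\mathcal{K}_{m-2}(A,u_q)$, and $A_{m-2}=(U_{m-2},A\,U_{m-2})_M$. Let $\mathcal{K}_m(A,u_q)$ refer to the extended Krylov subspace $$\mathcal{K}_m(A,u_q)=\mathcal{Q}_{m-2}(A,u)\oplus\operatorname{span}\{Au,A^2u\}.$$ Let $V_m=(v_1,\dots,v_m)\in\mathbb{C}^{n\times m}$ be the $M$-orthonormal basis of $\mathcal{K}_m(A,u_q)$ provided by the Lanczos method, and $J_m$ the Jacobi matrix of $\mathcal{K}_m(A,u_q)$. Then the following statements hold true and provide a procedure to compute the qor-Krylov representation $\widetilde B_m$ for a given $\xi\in\mathbb{R}$ (with $p_{m-1}(\xi)\neq 0$, see context) and the basis $\widetilde U_m$ (given below) of the extended Krylov subspace $\mathcal{K}_m(A,u_q)$. (i) With $\widetilde U_m=(U_{m-2},v_{m-1},v_m)\in\mathbb{C}^{n\times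 m}$ we have an $M$-orthonormal basis of the extended Krylov subspace $\mathcal{K}_m(A,u_q)$, i.e., $\operatorname{span}\{\widetilde U_m\}=\mathcal{K}_m(A,u_q)$ and $(\widetilde U_m,\widetilde U_m)_M=I$. Furthermore, $\widetilde U_m$ can be computed without reference to $u_q$. (ii) The Rayleigh quotient $\widetilde A_m=(\widetilde U_m,A\,\widetilde U_m)_M$ of the extended Krylov subspace is given by $$\widetilde A_m=\begin{pmatrix}\widetilde A_{m-1}&\beta_{m-1}e_{m-1}\\ \beta_{m-1}e_{m-1}^{H}&a_m\end{pmatrix}\in\mathbb{C}^{m\times m},\qquad \widetilde A_{m-1}=\begin{pmatrix}A_{m-2}&\widetilde a\\ \widetilde a^{H}&a_{m-1}\end{pmatrix}\in\mathbb{C}^{(m-1)\times(m-1)},$$ with $\widetilde a=(U_{m-2},A\,v_{m-1})_M\in\mathbb{C}^{m-2}$. Furthermore, $a_m=(J_m)_{m,m}$, $a_{m-1}=(J_m)_{m-1,m-1}$ and $\beta_{m-1}=(J_m)_{m,m-1}$. The matrix entries $a_m$, $a_{m-1}$, $\beta_{m-1}$ and $\widetilde a$ are computed in the course of the orthogonalization procedure in (i) (see context). (iii) For the basis transformation $\widetilde K_m=(V_m,\widetilde U_m)_M$ we have $$\widetilde K_m=\begin{pmatrix}K_{m-2}&0\\0&I_2\end{pmatrix},\qquad I_2=\begin{pmatrix}1&0\\0&1\end{pmatrix},\qquad K_{m-2}=(V_{m-2},U_{m-2})_M,$$ where $V_{m-2}=(v_1,\dots,v_{m-2})$. (iv) Let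 $T_m$ be the qor-Krylov matrix for $\mathcal{K}_m(A,u_q)$ and $\xi$ (see context). Then $\widetilde B_m=\widetilde K_m^{H}\,T_m\,\widetilde K_m$ satisfies $$\widetilde B_m=\begin{pmatrix}\widetilde A_{m-1}&\beta_{m-1}e_{m-1}\\ \beta_{m-1}e_{m-1}^{H}&\omega_m\end{pmatrix}\qquad\text{with}\qquad \omega_m=\xi+\beta_{m-1}^2\,e_{m-1}^{H}(\widetilde A_{m-1}-\xi I)^{-1}e_{m-1}.$$
   Context: $M\in\mathbb{C}^{n\times n}$ is Hermitian positive definite; $(X,Y)_M=X^{H}MY$ also for matrices $X,Y$ with $n$ rows. $\mathcal{K}_j(A,v)=\operatorname{span}\{v,Av,\dots,A^{j-1}v\}$, and $\mathcal{Q}_{m-2}(A,u)=\{p(A)q_{m-3}(A)^{-1}u:\ \deg p\le m-3\}$. $e_{m-1}=(0,\dots,0,1)^{T}\in\mathbb{R}^{m-1}$. Lanczos data for $\mathcal{K}_m(A,u_q)$: let $p_0,\dots,p_m$ ($\deg p_j=j$, positive leading coefficients) be the polynomials orthonormal for $(f,g)\mapsto(f(A)u_q,g(A)u_q)_M$; they satisfy $\lambda p_{j-1}=\beta_{j-1}p_{j-2}+a_jp_{j-1}+\beta_jp_j$ for $j=1,\dots,m$ with $p_{-1}=0$, $a_j\in\mathbb{R}$, $\beta_j>0$. Then $v_j=p_{j-1}(A)u_q$, and $J_m=(V_m,AV_m)_M\in\mathbb{R}^{m\times m}$ is the symmetric tridiagonal Jacobi matrix with diagonal $a_1,\dots,a_m$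 and off-diagonals $\beta_1,\dots,\beta_{m-1}$. qor-Krylov (quasi-orthogonal residual) representation: for $\xi\in\mathbb{R}$ with $p_{m-1}(\xi)\neq0$, $T_m$ is the matrix obtained from $J_m$ by replacing the entry $(J_m)_{m,m}=a_m$ by $\omega_m=\xi-\beta_{m-1}\,p_{m-2}(\xi)/p_{m-1}(\xi)$ (so that $\xi$ is an eigenvalue of $T_m$). Part (iv) gives this $\omega_m$ in terms of $\widetilde A_{m-1}$. Orthogonalization procedure meant in (i) and (ii): $v_{m-1}$ is constructed by $M$-orthogonalizing $Au$ against $U_{m-2}$ and normalizing, and in a similar manner $v_m$ is constructed via $Av_{m-1}$. *)

theory Defs
  imports "Jordan_Normal_Form.Schur_Decomposition"
begin

text \<open>
  Vectors and matrices are those of \<open>Jordan_Normal_Form\<close>, whose indices start at 0.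
  There \<open>x \<bullet>c y\<close> conjugates the \<^emph>\<open>second\<close> argument, whence the order of the arguments in
  \<open>ip\<close> below.
\<close>

definition ip :: "complex mat \<Rightarrow> complex vec \<Rightarrow> complex vec \<Rightarrow> complex" where
  "ip M x y = (M *\<^sub>v y) \<bullet>c x"

definition ip_norm :: "complex mat \<Rightarrow> complex vec \<Rightarrow> real" where
  "ip_norm M x = sqrt (Re (ip M x x))"

definition gram :: "complex mat \<Rightarrow> complex mat \<Rightarrow> complex mat \<Rightarrow> complex mat" where
  "gram M X Y = mat_adjoint X * M * Y"

definition gram_vec :: "complex mat \<Rightarrow> complex mat \<Rightarrow> complex vec \<Rightarrow> complex vec" where
  "gram_vec M X y = mat_adjoint X *\<^sub>v (M *\<^sub>v y)"

text \<open>Hermitian symmetry makes \<open>ip M x x\<close> real, so taking the real part loses nothing.\<close>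

definition hermitian_pos_def :: "nat \<Rightarrow> complex mat \<Rightarrow> bool" where
  "hermitian_pos_def n M \<longleftrightarrow> M \<in> carrier_mat n n \<and> mat_adjoint M = M \<and>
     (\<forall>x\<in>carrier_vec n. x \<noteq> 0\<^sub>v n \<longrightarrow> 0 < Re (ip M x x))"

definition self_adjoint_wrt :: "nat \<Rightarrow> complex mat \<Rightarrow> complex mat \<Rightarrow> bool" where
  "self_adjoint_wrt n M A \<longleftrightarrow> A \<in> carrier_mat n n \<and>
     (\<forall>x\<in>carrier_vec n. \<forall>y\<in>carrier_vec n. ip M (A *\<^sub>v x) y = ip M x (A *\<^sub>v y))"

definition orthonormal_eigenbasis :: "nat \<Rightarrow> complex mat \<Rightarrow> complex mat \<Rightarrow> complex mat \<Rightarrow> bool" where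
  "orthonormal_eigenbasis n M A W \<longleftrightarrow> W \<in> carrier_mat n n \<and> gram M W W = 1\<^sub>m n \<and>
     (\<forall>j<n. \<exists>\<mu>. eigenvector A (col W j) \<mu>)"

text \<open>\<open>mat_inv\<close> is meaningful for invertible matrices only.\<close>

definition mat_inv :: "complex mat \<Rightarrow> complex mat" where
  "mat_inv B = the (mat_inverse B)"

text \<open>\<open>p(A) = \<Sum>\<^sub>k p\<^sub>k A\<^sup>k\<close>, written entrywise.\<close>

definition poly_mat :: "complex poly \<Rightarrow> complex mat \<Rightarrow> complex mat" where
  "poly_mat p A = mat (dim_row A) (dim_row A)
     (\<lambda>(i, j). \<Sum>k\<le>degree p. coeff p k * (A ^\<^sub>m k) $$ (i, j))"

abbreviation real_poly_mat :: "real poly \<Rightarrow> complex mat \<Rightarrow> complex mat" where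
  "real_poly_mat p A \<equiv> poly_mat (map_poly complex_of_real p) A"

definition vec_span :: "nat \<Rightarrow> complex vec set \<Rightarrow> complex vec set" where
  "vec_span n S = LinearCombinations.module.span class_ring (module_vec TYPE(complex) n) S"

definition is_direct_sum :: "nat \<Rightarrow> complex vec set \<Rightarrow> complex vec set \<Rightarrow> complex vec set \<Rightarrow> bool" where
  "is_direct_sum n W X Y \<longleftrightarrow> W = {x + y | x y. x \<in> X \<and> y \<in> Y} \<and> X \<inter> Y = {0\<^sub>v n}"

definition krylov :: "nat \<Rightarrow> nat \<Rightarrow> complex mat \<Rightarrow> complex vec \<Rightarrow> complex vec set" where
  "krylov n j A v = vec_span n ((\<lambda>i. (A ^\<^sub>m i) *\<^sub>v v) ` {..<j})"

definition rational_krylov ::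
    "nat \<Rightarrow> complex poly \<Rightarrow> complex mat \<Rightarrow> complex vec \<Rightarrow> complex vec set" where
  "rational_krylov j q A u =
     {poly_mat p A *\<^sub>v (mat_inv (poly_mat q A) *\<^sub>v u) | p. degree p \<le> j - 1}"

datatype pole = Finite complex | PlusInfinity | MinusInfinity

definition denominator :: "pole list \<Rightarrow> complex poly" where
  "denominator s = prod_list [[:- c, 1:]. Finite c \<leftarrow> s]"

text \<open>
  Lanczos data of \<open>\<K>\<^sub>m(A, w)\<close>: \<open>p j\<close> is the orthonormal polynomial of degree \<open>j\<close>
  (\<open>0 \<le> j \<le> m\<close>), and \<open>a j\<close>, \<open>b j\<close> (\<open>1 \<le> j \<le> m\<close>) are the coefficients of its recurrence;
  \<open>p\<^sub>-\<^sub>1 = 0\<close> is encoded by the case distinction, so \<open>b 0\<close> is irrelevant.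
\<close>

definition lanczos_data ::
    "complex mat \<Rightarrow> complex mat \<Rightarrow> complex vec \<Rightarrow> nat \<Rightarrow>
     (nat \<Rightarrow> real poly) \<Rightarrow> (nat \<Rightarrow> real) \<Rightarrow> (nat \<Rightarrow> real) \<Rightarrow> bool" where
  "lanczos_data M A w m p a b \<longleftrightarrow>
     (\<forall>j\<le>m. degree (p j) = j \<and> 0 < lead_coeff (p j)) \<and>
     (\<forall>i\<le>m. \<forall>j\<le>m. ip M (real_poly_mat (p i) A *\<^sub>v w) (real_poly_mat (p j) A *\<^sub>v w)
        = (if i = j then 1 else 0)) \<and>
     (\<forall>j\<in>{1..m}. [:0, 1:] * p (j - 1) =
        (if j = 1 then 0 else smult (b (j - 1)) (p (j - 2)))
          + smult (a j) (p (j - 1)) + smult (b j) (p j)) \<and>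
     (\<forall>j\<in>{1..m}. 0 < b j)"

definition lanczos_vec ::
    "complex mat \<Rightarrow> complex vec \<Rightarrow> (nat \<Rightarrow> real poly) \<Rightarrow> nat \<Rightarrow> complex vec" where
  "lanczos_vec A w p j = real_poly_mat (p (j - 1)) A *\<^sub>v w"

definition lanczos_basis ::
    "nat \<Rightarrow> complex mat \<Rightarrow> complex vec \<Rightarrow> (nat \<Rightarrow> real poly) \<Rightarrow> nat \<Rightarrow> complex mat" where
  "lanczos_basis n A w p k = mat_of_cols n (map (lanczos_vec A w p) [1..<Suc k])"

definition append_cols :: "complex mat \<Rightarrow> complex vec list \<Rightarrow> complex mat" where
  "append_cols X vs = mat_of_cols (dim_row X) (cols X @ vs)"

text \<open>The block matrix with rows \<open>(B, x)\<close> and \<open>(x\<^sup>H, d)\<close>.\<close>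

definition bordered_mat :: "complex mat \<Rightarrow> complex vec \<Rightarrow> complex \<Rightarrow> complex mat" where
  "bordered_mat B x d =
     (let X = mat_of_cols (dim_vec x) [x] in four_block_mat B X (mat_adjoint X) (mat 1 1 (\<lambda>_. d)))"

text \<open>
  The two orthogonalization steps that extend an orthonormal basis \<open>U\<close>, using only \<open>M\<close>, \<open>A\<close>,
  \<open>u\<close> and \<open>U\<close>. The result \<open>(v, v', h, \<beta>, \<alpha>)\<close> consists of the two new basis vectors, the
  coefficients \<open>h\<close> and the norm \<open>\<beta>\<close> arising when \<open>A v\<close> is orthogonalized against \<open>(U, v)\<close>
  and normalized, and the Rayleigh quotient \<open>\<alpha>\<close> of \<open>v'\<close>.
\<close>

definition extend_orthonormal_basis ::
    "complex mat \<Rightarrow> complex mat \<Rightarrow> complex vec \<Rightarrow> complex mat \<Rightarrow>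
     complex vec \<times> complex vec \<times> complex vec \<times> real \<times> complex" where
  "extend_orthonormal_basis M A u U =
     (let x = A *\<^sub>v u;
          w = x - U *\<^sub>v gram_vec M U x;
          v = complex_of_real (1 / ip_norm M w) \<cdot>\<^sub>v w;
          U' = append_cols U [v];
          y = A *\<^sub>v v;
          h = gram_vec M U' y;
          w' = y - U' *\<^sub>v h;
          \<beta> = ip_norm M w';
          v' = complex_of_real (1 / \<beta>) \<cdot>\<^sub>v w'
      in (v, v', h, \<beta>, ip M v' (A *\<^sub>v v')))"

end

theory Submission
  imports Defs
begin

text \<open>
  Every vector in sight is \<open>f(A) w\<close> with \<open>w = q(A)\<^sup>-\<^sup>1 u\<close> and a polynomial \<open>f\<close>, and
  orthonormality of \<open>p\<^sub>0(A) w, \<dots>, p\<^sub>m(A) w\<close> makes \<open>f \<mapsto> f(A) w\<close> injective in degree at most \<open>m\<close>.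
  The columns of \<open>U\<close> and the first \<open>m - 2\<close> Lanczos vectors span the same space, to which
  \<open>v\<^sub>m\<^sub>-\<^sub>1\<close> and \<open>v\<^sub>m\<close> are orthogonal; since \<open>A\<close> is self-adjoint and raises the degree by one, this gives
  the bordered shapes. As \<open>A u = (\<lambda> q)(A) w\<close> with \<open>\<lambda> q\<close> monic, the orthogonalization of \<open>A u\<close>
  yields \<open>v\<^sub>m\<^sub>-\<^sub>1\<close> exactly when \<open>deg q = m - 3\<close>. For \<open>\<omega>\<^sub>m\<close>, a solution \<open>y\<close> of
  \<open>(A\<^sub>m\<^sub>-\<^sub>1 - \<xi>) y = e\<^sub>m\<^sub>-\<^sub>1\<close> represents a polynomial \<open>f\<close> with
  \<open>(\<lambda> - \<xi>) f = p\<^sub>m\<^sub>-\<^sub>2 + \<beta>\<^sub>m\<^sub>-\<^sub>1 y\<^sub>m\<^sub>-\<^sub>1 p\<^sub>m\<^sub>-\<^sub>1\<close>, which is evaluated at \<open>\<xi>\<close>.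
\<close>

section \<open>Matrices with appended columns\<close>

lemma mat_adjoint_carrier [simp, intro]:
  "X \<in> carrier_mat n k \<Longrightarrow> mat_adjoint X \<in> carrier_mat k n"
  by (auto simp: mat_adjoint_def)

lemma dim_mat_adjoint [simp]:
  "dim_row (mat_adjoint X) = dim_col X" "dim_col (mat_adjoint X) = dim_row X"
  by (auto simp: mat_adjoint_def)

lemma row_mat_adjoint [simp]: "i < dim_col X \<Longrightarrow> row (mat_adjoint X) i = conjugate (col X i)"
  by (simp add: mat_adjoint_def)

lemma index_mat_adjoint [simp]:
  "i < dim_col X \<Longrightarrow> j < dim_row X \<Longrightarrow> mat_adjoint X $$ (i, j) = cnj (X $$ (j, i))"
  by (simp add: mat_adjoint_def mat_of_rows_def)

lemma dim_append_cols [simp]: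
  "dim_row (append_cols X vs) = dim_row X"
  "dim_col (append_cols X vs) = dim_col X + length vs"
  by (simp_all add: append_cols_def)

lemma append_cols_carrier [simp, intro]:
  "X \<in> carrier_mat n k \<Longrightarrow> append_cols X vs \<in> carrier_mat n (k + length vs)"
  by (auto intro!: carrier_matI)

lemma set_cols_append_cols:
  assumes "set vs \<subseteq> carrier_vec (dim_row X)"
  shows "set (cols (append_cols X vs)) = set (cols X) \<union> set vs"
proof -
  have "set (cols X) \<subseteq> carrier_vec (dim_row X)"
    using cols_dim by blast
  then show ?thesis
    using assms by (simp add: append_cols_def cols_mat_of_cols)
qed

lemma append_cols_append:
  assumes "set vs \<subseteq> carrier_vec (dim_row X)"
  shows "append_cols (append_cols X vs) ws = append_cols X (vs @ ws)"
proof -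
  have "set (cols X) \<subseteq> carrier_vec (dim_row X)"
    using cols_dim by blast
  then show ?thesis
    using assms by (simp add: append_cols_def cols_mat_of_cols)
qed

lemma col_append_cols:
  assumes "v \<in> carrier_vec (dim_row X)" "j < Suc (dim_col X)"
  shows "col (append_cols X [v]) j = (if j < dim_col X then col X j else v)"
proof -
  have "(cols X @ [v]) ! j = (if j < dim_col X then col X j else v)"
    using assms by (simp add: nth_append)
  moreover have "(if j < dim_col X then col X j else v) \<in> carrier_vec (dim_row X)"
    using assms by auto
  ultimately show ?thesis
    using assms by (simp add: append_cols_def)
qed

text \<open>The last coordinate multiplies the appended column. This turns the range of an enlarged
  matrix into the old range plus multiples of \<open>v\<close>.\<close>

lemma append_cols_mult_vec:
  assumes "X \<in> carrier_mat n k" "v \<in> carrier_vec n" "x \<in> carrier_vec k"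
  shows "append_cols X [v] *\<^sub>v (x @\<^sub>v vec 1 (\<lambda>_. \<alpha>)) = X *\<^sub>v x + \<alpha> \<cdot>\<^sub>v v"
proof (rule eq_vecI)
  fix i assume "i < dim_vec (X *\<^sub>v x + \<alpha> \<cdot>\<^sub>v v)"
  then have i: "i < n" using assms by auto
  have ent: "append_cols X [v] $$ (i, j) = (if j < k then X $$ (i, j) else v $ i)"
    if "j < Suc k" for j
    using that i assms by (auto simp: append_cols_def mat_of_cols_def nth_append)
  have "(append_cols X [v] *\<^sub>v (x @\<^sub>v vec 1 (\<lambda>_. \<alpha>))) $ i
      = (\<Sum>j<Suc k. append_cols X [v] $$ (i, j) * (x @\<^sub>v vec 1 (\<lambda>_. \<alpha>)) $ j)"
    using i assms by (auto simp: scalar_prod_def lessThan_atLeast0 intro!: sum.cong)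
  also have "\<dots> = (\<Sum>j<k. X $$ (i, j) * x $ j) + v $ i * \<alpha>"
    using assms by (auto simp: ent intro!: sum.cong)
  also have "\<dots> = (X *\<^sub>v x + \<alpha> \<cdot>\<^sub>v v) $ i"
    using i assms by (auto simp: scalar_prod_def lessThan_atLeast0 intro!: sum.cong)
  finally show "(append_cols X [v] *\<^sub>v (x @\<^sub>v vec 1 (\<lambda>_. \<alpha>))) $ i
      = (X *\<^sub>v x + \<alpha> \<cdot>\<^sub>v v) $ i" .
qed (use assms in auto)

section \<open>Spans\<close>

lemma mult_unit_vec:
  fixes X :: "'a :: semiring_1 mat"
  assumes "X \<in> carrier_mat n k" "i < k"
  shows "X *\<^sub>v unit_vec k i = col X i"
  using assms by (intro eq_vecI) auto

lemma col_space_eq_image: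
  "X \<in> carrier_mat n k \<Longrightarrow> vec_space.col_space n X = (*\<^sub>v) X ` carrier_vec k"
  by (subst vec_space.col_space_eq) auto

lemma vec_span_set_cols: "vec_span n (set (cols X)) = vec_space.col_space n X"
  by (simp add: vec_span_def vec_space.col_space_def)

lemma col_space_append_cols:
  assumes "X \<in> carrier_mat n k" "v \<in> carrier_vec n"
  shows "vec_space.col_space n (append_cols X [v])
    = {x + \<alpha> \<cdot>\<^sub>v v | x \<alpha>. x \<in> vec_space.col_space n X}" (is "?l = ?r")
proof -
  have eq: "?l = (*\<^sub>v) (append_cols X [v]) ` carrier_vec (Suc k)"
    using assms by (intro col_space_eq_image) auto
  have X: "vec_space.col_space n X = (*\<^sub>v) X ` carrier_vec k"
    using assms by (intro col_space_eq_image) auto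
  show ?thesis
  proof (intro equalityI subsetI)
    fix y assume "y \<in> ?l"
    then obtain c where c: "c \<in> carrier_vec (Suc k)" "y = append_cols X [v] *\<^sub>v c"
      using eq by auto
    have "c = vec_first c k @\<^sub>v vec 1 (\<lambda>_. c $ k)"
      using c(1) by (intro eq_vecI) (auto simp: vec_first_def less_Suc_eq)
    then have "y = append_cols X [v] *\<^sub>v (vec_first c k @\<^sub>v vec 1 (\<lambda>_. c $ k))"
      using c(2) by simp
    also have "\<dots> = X *\<^sub>v vec_first c k + c $ k \<cdot>\<^sub>v v"
      using assms by (intro append_cols_mult_vec) auto
    finally have "y = X *\<^sub>v vec_first c k + c $ k \<cdot>\<^sub>v v" .
    then show "y \<in> ?r" using X by auto
  next
    fix y assume "y \<in> ?r"
    then obtain c \<alpha> where "c \<in> carrier_vec k" "y = X *\<^sub>v c + \<alpha> \<cdot>\<^sub>v v"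
      using X by auto
    then have "y = append_cols X [v] *\<^sub>v (c @\<^sub>v vec 1 (\<lambda>_. \<alpha>))"
      "c @\<^sub>v vec 1 (\<lambda>_. \<alpha>) \<in> carrier_vec (Suc k)"
      using assms by (simp_all only: append_cols_mult_vec) (auto intro!: carrier_vecI)
    then show "y \<in> ?l" using eq by auto
  qed
qed

text \<open>A finite set can be listed as the columns of a matrix, so the claim reduces to the
  column space after appending one column.\<close>

lemma vec_span_insert:
  assumes "finite S" "S \<subseteq> carrier_vec n" "v \<in> carrier_vec n"
  shows "vec_span n (insert v S) = {x + \<alpha> \<cdot>\<^sub>v v | x \<alpha>. x \<in> vec_span n S}"
proof -
  obtain xs where xs: "set xs = S" using assms finite_list by blast
  have car: "mat_of_cols n xs \<in> carrier_mat n (length xs)" by simp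
  have 1: "set (cols (mat_of_cols n xs)) = S" using xs assms by (simp add: cols_mat_of_cols)
  have 2: "set (cols (append_cols (mat_of_cols n xs) [v])) = insert v S"
    using assms 1 by (subst set_cols_append_cols) auto
  show ?thesis
    using col_space_append_cols[OF car assms(3)]
    by (simp flip: vec_span_set_cols add: 1 2)
qed

lemma vec_span_empty: "vec_span n {} = {0\<^sub>v n}"
proof -
  have "vec_span n (set (cols (mat_of_cols n []))) = {0\<^sub>v n}"
  proof -
    have "mat_of_cols n [] *\<^sub>v c = 0\<^sub>v n" if "c \<in> carrier_vec 0" for c :: "complex vec"
      using that by (intro eq_vecI) (auto simp: scalar_prod_def)
    moreover have "vec_space.col_space n (mat_of_cols n [])
        = (*\<^sub>v) (mat_of_cols n []) ` (carrier_vec 0 :: complex vec set)"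
      by (intro col_space_eq_image carrier_matI) simp_all
    moreover have "(carrier_vec 0 :: complex vec set) \<noteq> {}"
      using zero_carrier_vec by blast
    ultimately show ?thesis unfolding vec_span_set_cols
      by (metis (no_types, lifting) image_cong image_constant_conv)
  qed
  then show ?thesis by simp
qed

lemma vec_span_pair:
  assumes "x \<in> carrier_vec n" "y \<in> carrier_vec n"
  shows "vec_span n {x, y} = {\<alpha> \<cdot>\<^sub>v x + \<gamma> \<cdot>\<^sub>v y | \<alpha> \<gamma>. True}"
proof -
  have "vec_span n {x, y} = vec_span n (insert y {x})" by (simp add: insert_commute)
  also have "\<dots> = {\<alpha> \<cdot>\<^sub>v x + \<gamma> \<cdot>\<^sub>v y | \<alpha> \<gamma>. True}"
    using assms by (subst vec_span_insert, (auto)[3])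
      (subst vec_span_insert, auto simp: vec_span_empty)
  finally show ?thesis .
qed

section \<open>The weighted inner product\<close>

lemma zero_smult_vec: "(x :: 'a :: semiring_0 vec) \<in> carrier_vec n \<Longrightarrow> 0 \<cdot>\<^sub>v x = 0\<^sub>v n"
  by (intro eq_vecI) auto

lemma ip_add_right:
  assumes "M \<in> carrier_mat n n" "x \<in> carrier_vec n" "y \<in> carrier_vec n" "z \<in> carrier_vec n"
  shows "ip M x (y + z) = ip M x y + ip M x z"
  using assms unfolding ip_def
  by (simp add: mult_add_distrib_mat_vec add_scalar_prod_distrib[of _ n])

lemma ip_smult_right:
  assumes "M \<in> carrier_mat n n" "x \<in> carrier_vec n" "y \<in> carrier_vec n"
  shows "ip M x (\<alpha> \<cdot>\<^sub>v y) = \<alpha> * ip M x y"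
  using assms unfolding ip_def by (simp add: mult_mat_vec)

lemma ip_zero_right:
  assumes "M \<in> carrier_mat n n" "x \<in> carrier_vec n"
  shows "ip M x (0\<^sub>v n) = 0"
  using ip_smult_right[OF assms assms(2), of 0] zero_smult_vec[OF assms(2)] by simp

lemma ip_smult_left:
  assumes "M \<in> carrier_mat n n" "x \<in> carrier_vec n" "y \<in> carrier_vec n"
  shows "ip M (\<alpha> \<cdot>\<^sub>v x) y = cnj \<alpha> * ip M x y"
  using assms unfolding ip_def by (simp add: conjugate_smult_vec)

lemma mat_adjoint_scalar_prod:
  fixes B :: "complex mat"
  assumes "B \<in> carrier_mat n k" "x \<in> carrier_vec k" "y \<in> carrier_vec n"
  shows "(mat_adjoint B *\<^sub>v y) \<bullet>c x = y \<bullet>c (B *\<^sub>v x)"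
proof -
  have "(mat_adjoint B *\<^sub>v y) \<bullet>c x = (\<Sum>i<k. (\<Sum>j<n. cnj (B $$ (j, i)) * y $ j) * cnj (x $ i))"
    using assms by (auto simp: scalar_prod_def lessThan_atLeast0 intro!: sum.cong)
  also have "\<dots> = (\<Sum>j<n. \<Sum>i<k. cnj (B $$ (j, i)) * y $ j * cnj (x $ i))"
    by (subst sum.swap) (simp add: sum_distrib_right)
  also have "\<dots> = y \<bullet>c (B *\<^sub>v x)"
    using assms
    by (auto simp: scalar_prod_def lessThan_atLeast0 sum_distrib_left sum_distrib_right mult_ac
      intro!: sum.cong)
  finally show ?thesis .
qed

text \<open>\<open>M\<close> equals its adjoint and so may be moved to the other argument of the
  product; the order of the two factors is then reversed by conjugation.\<close>

lemma ip_cnj: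
  assumes "hermitian_pos_def n M" "x \<in> carrier_vec n" "y \<in> carrier_vec n"
  shows "ip M x y = cnj (ip M y x)"
proof -
  have M: "M \<in> carrier_mat n n" "mat_adjoint M = M"
    using assms by (auto simp: hermitian_pos_def_def)
  have "ip M x y = y \<bullet>c (M *\<^sub>v x)"
    using mat_adjoint_scalar_prod[OF M(1) assms(2,3)] M by (simp add: ip_def)
  also have "\<dots> = cnj (ip M y x)"
    using assms M
    by (auto simp: ip_def scalar_prod_def mult.commute intro!: sum.cong)
  finally show ?thesis .
qed

lemma gram_carrier [simp, intro]:
  "X \<in> carrier_mat n k \<Longrightarrow> Y \<in> carrier_mat n l \<Longrightarrow> gram M X Y \<in> carrier_mat k l"
  by (auto simp: gram_def)

lemma dim_gram [simp]: "dim_row (gram M X Y) = dim_col X" "dim_col (gram M X Y) = dim_col Y"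
  by (auto simp: gram_def)

lemma dim_gram_vec [simp]: "dim_vec (gram_vec M X y) = dim_col X"
  by (auto simp: gram_vec_def)

lemma gram_vec_index:
  assumes "M \<in> carrier_mat n n" "X \<in> carrier_mat n k" "y \<in> carrier_vec n" "i < k"
  shows "gram_vec M X y $ i = ip M (col X i) y"
  using assms by (auto simp: gram_vec_def ip_def intro!: comm_scalar_prod[of _ n])

lemma gram_index:
  assumes "M \<in> carrier_mat n n" "X \<in> carrier_mat n k" "Y \<in> carrier_mat n l" "i < k" "j < l"
  shows "gram M X Y $$ (i, j) = ip M (col X i) (col Y j)"
proof -
  have "gram M X Y = mat_adjoint X * (M * Y)"
    using assms unfolding gram_def by (intro assoc_mult_mat) auto
  moreover have "col (M * Y) j = M *\<^sub>v col Y j"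
    using assms by (auto simp: col_mult2)
  ultimately show ?thesis
    using assms by (auto simp: ip_def intro!: comm_scalar_prod[of _ n])
qed

lemma gram_vec_mult:
  assumes "M \<in> carrier_mat n n" "X \<in> carrier_mat n k" "Y \<in> carrier_mat n l" "c \<in> carrier_vec l"
  shows "gram_vec M X (Y *\<^sub>v c) = gram M X Y *\<^sub>v c"
  using assms unfolding gram_vec_def gram_def
  by (simp add: assoc_mult_mat_vec[of _ n n _ l] assoc_mult_mat_vec[of _ k n _ l] assoc_mult_mat[of _ k n _ n _ l])

lemma gram_vec_add:
  assumes "M \<in> carrier_mat n n" "X \<in> carrier_mat n k" "y \<in> carrier_vec n" "z \<in> carrier_vec n"
  shows "gram_vec M X (y + z) = gram_vec M X y + gram_vec M X z"
  using assms mult_mat_vec_carrier[of M n n]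
  by (simp add: gram_vec_def mult_add_distrib_mat_vec[of _ n n] mult_add_distrib_mat_vec[of _ k n])

lemma gram_vec_smult:
  assumes "M \<in> carrier_mat n n" "X \<in> carrier_mat n k" "y \<in> carrier_vec n"
  shows "gram_vec M X (c \<cdot>\<^sub>v y) = c \<cdot>\<^sub>v gram_vec M X y"
  using assms mult_mat_vec_carrier[of M n n]
  by (simp add: gram_vec_def mult_mat_vec[of _ n n] mult_mat_vec[of _ k n])

lemma gram_mult_right:
  assumes "M \<in> carrier_mat n n" "X \<in> carrier_mat n k" "Y \<in> carrier_mat n l" "B \<in> carrier_mat l r"
  shows "gram M X (Y * B) = gram M X Y * B"
  using assms unfolding gram_def
  by (subst assoc_mult_mat[of _ k n _ l _ r]) auto

lemma mat_adjoint_mult: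
  fixes B C :: "complex mat"
  assumes "B \<in> carrier_mat n k" "C \<in> carrier_mat k l"
  shows "mat_adjoint (B * C) = mat_adjoint C * mat_adjoint B"
  using assms
  by (intro eq_matI) (auto simp: scalar_prod_def mult.commute intro!: sum.cong)

lemma gram_mult_left:
  assumes "M \<in> carrier_mat n n" "X \<in> carrier_mat n k" "Y \<in> carrier_mat n l" "B \<in> carrier_mat k r"
  shows "gram M (X * B) Y = mat_adjoint B * gram M X Y"
proof -
  have "mat_adjoint B * mat_adjoint X * M * Y = mat_adjoint B * (mat_adjoint X * M) * Y"
    using assms by (subst assoc_mult_mat[of _ r k _ n _ n]) auto
  also have "\<dots> = mat_adjoint B * (mat_adjoint X * M * Y)"
    using assms by (intro assoc_mult_mat[of _ r k _ n _ l]) auto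
  finally show ?thesis by (simp add: gram_def mat_adjoint_mult[OF assms(2,4)])
qed

text \<open>If \<open>x = X c\<close>, orthonormality of the columns recovers \<open>c\<close> as
  \<open>gram_vec M X x\<close>. Thus \<open>X *\<^sub>v gram_vec M X x\<close> is the
  \<open>M\<close>-orthogonal projection of \<open>x\<close>, and it fixes the range of
  \<open>X\<close>.\<close>

lemma project_col_space:
  assumes "M \<in> carrier_mat n n" "X \<in> carrier_mat n k" "gram M X X = 1\<^sub>m k"
    and "x \<in> vec_space.col_space n X"
  shows "X *\<^sub>v gram_vec M X x = x"
proof -
  obtain c where c: "c \<in> carrier_vec k" "x = X *\<^sub>v c"
    using assms col_space_eq_image[OF assms(2)] by auto
  then have "gram_vec M X x = c" using assms by (simp add: gram_vec_mult[of _ n])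
  then show ?thesis using c by simp
qed

lemma gram_vec_orthogonal:
  assumes "M \<in> carrier_mat n n" "X \<in> carrier_mat n k" "y \<in> carrier_vec n"
    and "\<And>x. x \<in> vec_space.col_space n X \<Longrightarrow> ip M x y = 0"
  shows "gram_vec M X y = 0\<^sub>v k"
proof (rule eq_vecI)
  fix i assume i: "i < dim_vec (0\<^sub>v k)"
  have "col X i = X *\<^sub>v unit_vec k i" using mult_unit_vec[OF assms(2)] i by simp
  then have "col X i \<in> vec_space.col_space n X"
    using assms i by (auto simp: col_space_eq_image[OF assms(2)])
  then show "gram_vec M X y $ i = 0\<^sub>v k $ i"
    using assms i by (simp add: gram_vec_index[of _ n _ k])
qed (use assms in auto)

section \<open>Polynomials of a matrix and Krylov subspaces\<close>

lemma pow_mat_Suc_left: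
  assumes "A \<in> carrier_mat n n"
  shows "A ^\<^sub>m Suc k = A * A ^\<^sub>m k"
proof (induction k)
  case (Suc k)
  have "A ^\<^sub>m Suc (Suc k) = (A * A ^\<^sub>m k) * A" using Suc by simp
  also have "\<dots> = A * A ^\<^sub>m Suc k"
    using assms by (simp add: assoc_mult_mat[of _ n n _ n _ n])
  finally show ?case .
qed (use assms in auto)

lemma poly_mat_carrier [simp, intro]:
  "A \<in> carrier_mat n n \<Longrightarrow> poly_mat f A \<in> carrier_mat n n"
  by (auto simp: poly_mat_def)

lemma dim_poly_mat [simp]:
  "dim_row (poly_mat f A) = dim_row A" "dim_col (poly_mat f A) = dim_row A"
  by (simp_all add: poly_mat_def)

text \<open>Coefficients beyond the degree vanish, so the sum may be padded up to any bound
  \<open>N\<close>. Polynomials of different degrees can then share one index range.\<close>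

lemma poly_mat_index:
  assumes "A \<in> carrier_mat n n" "degree f \<le> N" "i < n" "j < n"
  shows "poly_mat f A $$ (i, j) = (\<Sum>k\<le>N. coeff f k * (A ^\<^sub>m k) $$ (i, j))"
proof -
  have "poly_mat f A $$ (i, j) = (\<Sum>k\<le>degree f. coeff f k * (A ^\<^sub>m k) $$ (i, j))"
    using assms by (simp add: poly_mat_def)
  also have "\<dots> = (\<Sum>k\<le>N. coeff f k * (A ^\<^sub>m k) $$ (i, j))"
    using assms by (intro sum.mono_neutral_left) (auto simp: coeff_eq_0)
  finally show ?thesis .
qed

lemma poly_mat_add:
  assumes "A \<in> carrier_mat n n"
  shows "poly_mat (f + g) A = poly_mat f A + poly_mat g A"
proof (rule eq_matI)
  fix i j assume "i < dim_row (poly_mat f A + poly_mat g A)" "j < dim_col (poly_mat f A + poly_mat g A)"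
  then have ij: "i < n" "j < n" using poly_mat_carrier[OF assms, of g] by auto
  let ?N = "max (degree f) (degree g)"
  have "degree (f + g) \<le> ?N" by (rule degree_add_le_max)
  then show "poly_mat (f + g) A $$ (i, j) = (poly_mat f A + poly_mat g A) $$ (i, j)"
    using ij carrier_matD[OF assms]
    by (simp add: poly_mat_index[OF assms, of _ ?N] algebra_simps sum.distrib)
qed (use assms poly_mat_carrier[of A n] in auto)

lemma poly_mat_smult:
  assumes "A \<in> carrier_mat n n"
  shows "poly_mat (smult c f) A = c \<cdot>\<^sub>m poly_mat f A"
proof (rule eq_matI)
  fix i j assume "i < dim_row (c \<cdot>\<^sub>m poly_mat f A)" "j < dim_col (c \<cdot>\<^sub>m poly_mat f A)"
  then have ij: "i < n" "j < n" using poly_mat_carrier[OF assms, of f] by auto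
  then show "poly_mat (smult c f) A $$ (i, j) = (c \<cdot>\<^sub>m poly_mat f A) $$ (i, j)"
    using ij carrier_matD[OF assms]
    by (simp add: poly_mat_index[OF assms, of _ "degree f"] degree_smult_le sum_distrib_left mult_ac)
qed (use assms poly_mat_carrier[of A n] in auto)

text \<open>This is the Horner step. It is the basis for the later inductions over
  \<open>pCons\<close>.\<close>

lemma poly_mat_pCons:
  assumes "A \<in> carrier_mat n n"
  shows "poly_mat (pCons c f) A = c \<cdot>\<^sub>m 1\<^sub>m n + A * poly_mat f A"
proof (rule eq_matI)
  have P: "poly_mat f A \<in> carrier_mat n n" using assms by simp
  fix i j assume "i < dim_row (c \<cdot>\<^sub>m 1\<^sub>m n + A * poly_mat f A)"
    "j < dim_col (c \<cdot>\<^sub>m 1\<^sub>m n + A * poly_mat f A)"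
  then have ij: "i < n" "j < n" using P assms by auto
  let ?N = "degree f"
  have pow: "(A ^\<^sub>m Suc k) $$ (i, j) = (\<Sum>l<n. A $$ (i, l) * (A ^\<^sub>m k) $$ (l, j))" for k
    using assms ij unfolding pow_mat_Suc_left[OF assms]
    by (auto simp: scalar_prod_def lessThan_atLeast0 intro!: sum.cong)
  have "poly_mat (pCons c f) A $$ (i, j)
      = (\<Sum>k\<le>Suc ?N. coeff (pCons c f) k * (A ^\<^sub>m k) $$ (i, j))"
    using ij by (intro poly_mat_index[OF assms]) (simp_all add: degree_pCons_le)
  also have "\<dots> = c * (A ^\<^sub>m 0) $$ (i, j) + (\<Sum>k\<le>?N. coeff f k * (A ^\<^sub>m Suc k) $$ (i, j))"
    by (subst sum.atMost_Suc_shift) simp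
  also have "\<dots> = c * (1\<^sub>m n) $$ (i, j)
      + (\<Sum>k\<le>?N. \<Sum>l<n. A $$ (i, l) * (coeff f k * (A ^\<^sub>m k) $$ (l, j)))"
    using assms by (simp only: pow) (simp add: sum_distrib_left mult_ac)
  also have "\<dots> = c * (1\<^sub>m n) $$ (i, j)
      + (\<Sum>l<n. A $$ (i, l) * (\<Sum>k\<le>?N. coeff f k * (A ^\<^sub>m k) $$ (l, j)))"
    by (subst sum.swap) (simp add: sum_distrib_left)
  also have "\<dots> = c * (1\<^sub>m n) $$ (i, j) + (\<Sum>l<n. A $$ (i, l) * poly_mat f A $$ (l, j))"
    using ij by (simp add: poly_mat_index[OF assms, of f ?N])
  also have "\<dots> = (c \<cdot>\<^sub>m 1\<^sub>m n + A * poly_mat f A) $$ (i, j)"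
    using assms P ij by (auto simp: scalar_prod_def lessThan_atLeast0 intro!: sum.cong)
  finally show "poly_mat (pCons c f) A $$ (i, j) = (c \<cdot>\<^sub>m 1\<^sub>m n + A * poly_mat f A) $$ (i, j)" .
qed (use assms poly_mat_carrier[of A n] in auto)

lemma smult_mat_mult_vec:
  "X \<in> carrier_mat n k \<Longrightarrow> x \<in> carrier_vec k \<Longrightarrow> (c \<cdot>\<^sub>m X) *\<^sub>v x = c \<cdot>\<^sub>v (X *\<^sub>v x)"
  by (intro eq_vecI) (auto simp: smult_scalar_prod_distrib[of _ k])

lemma mult_mat_vec_zero: "X \<in> carrier_mat n k \<Longrightarrow> X *\<^sub>v 0\<^sub>v k = 0\<^sub>v n"
  by (intro eq_vecI) auto

section \<open>The action of polynomials in \<open>A\<close> on vectors\<close>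

locale matrix_action =
  fixes n :: nat and A :: "complex mat"
  assumes A_carrier [simp]: "A \<in> carrier_mat n n"
begin

definition act :: "complex poly \<Rightarrow> complex vec \<Rightarrow> complex vec" where
  "act f x = poly_mat f A *\<^sub>v x"

lemma act_carrier [simp, intro]: "x \<in> carrier_vec n \<Longrightarrow> act f x \<in> carrier_vec n"
  unfolding act_def by (rule mult_mat_vec_carrier[OF poly_mat_carrier[OF A_carrier]])

lemma A_mult_carrier [simp, intro]: "x \<in> carrier_vec n \<Longrightarrow> A *\<^sub>v x \<in> carrier_vec n"
  by (rule mult_mat_vec_carrier[OF A_carrier])

lemma act_add: "x \<in> carrier_vec n \<Longrightarrow> act (f + g) x = act f x + act g x"
  unfolding act_def poly_mat_add[OF A_carrier]
  by (intro add_mult_distrib_mat_vec[of _ n n]) auto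

lemma act_smult: "x \<in> carrier_vec n \<Longrightarrow> act (smult c f) x = c \<cdot>\<^sub>v act f x"
  unfolding act_def poly_mat_smult[OF A_carrier]
  by (intro smult_mat_mult_vec[of _ n n]) auto

lemma act_pCons: "x \<in> carrier_vec n \<Longrightarrow> act (pCons c f) x = c \<cdot>\<^sub>v x + A *\<^sub>v act f x"
  unfolding act_def poly_mat_pCons[OF A_carrier]
  by (simp add: add_mult_distrib_mat_vec[of _ n n] smult_mat_mult_vec[of _ n n] 
       assoc_mult_mat_vec[of _ n n _ n] mult_carrier_mat[of _ n n _ n])

lemma act_diff: "x \<in> carrier_vec n \<Longrightarrow> act (f - g) x = act f x - act g x"
  using act_add[of x f "smult (-1) g"] act_smult[of x "-1" g]
  by (intro eq_vecI) (simp_all add: carrier_vecD[OF act_carrier])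

lemma act_0 [simp]: "x \<in> carrier_vec n \<Longrightarrow> act 0 x = 0\<^sub>v n"
  using act_smult[of x 0 0] zero_smult_vec[OF act_carrier[of x 0]] by simp

lemma act_const [simp]: "x \<in> carrier_vec n \<Longrightarrow> act [:c:] x = c \<cdot>\<^sub>v x"
  by (simp add: act_pCons mult_mat_vec_zero[OF A_carrier])

lemma act_1 [simp]: "x \<in> carrier_vec n \<Longrightarrow> act 1 x = x"
  by (simp add: one_pCons)

lemma act_shift: "x \<in> carrier_vec n \<Longrightarrow> act (pCons 0 f) x = A *\<^sub>v act f x"
  by (simp add: act_pCons zero_smult_vec)

lemma act_mult: "x \<in> carrier_vec n \<Longrightarrow> act (f * g) x = act f (act g x)"
proof (induction f)
  case (pCons c f)
  then show ?case by (simp add: act_add act_smult act_pCons[of _ c] act_shift)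
qed simp

lemma act_pow: "x \<in> carrier_vec n \<Longrightarrow> act (monom 1 k) x = A ^\<^sub>m k *\<^sub>v x"
proof (induction k)
  case (Suc k)
  have "A ^\<^sub>m Suc k *\<^sub>v x = A *\<^sub>v (A ^\<^sub>m k *\<^sub>v x)"
    unfolding pow_mat_Suc_left[OF A_carrier] using Suc.prems
    by (intro assoc_mult_mat_vec[of _ n n _ n]) auto
  with Suc show ?case by (simp add: monom_Suc act_shift)
qed (simp add: monom_0 carrier_matD(1)[OF A_carrier])

end

text \<open>Subtract the multiple of \<open>g\<close> that matches the coefficient at
  \<open>k\<close>. The vanishing of all coefficients from \<open>k\<close> on stands for a degree
  below \<open>k\<close>, and for \<open>k = 0\<close> it correctly leaves only the zero
  polynomial.\<close>

lemma poly_truncate: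
  fixes f g :: "'a :: field poly"
  assumes "degree g = k" "g \<noteq> 0" "\<And>i. i \<ge> Suc k \<Longrightarrow> coeff f i = 0"
  obtains h \<alpha> where "f = h + smult \<alpha> g" "\<And>i. i \<ge> k \<Longrightarrow> coeff h i = 0"
proof
  let ?\<alpha> = "coeff f k / coeff g k"
  show "f = (f - smult ?\<alpha> g) + smult ?\<alpha> g" by simp
  show "coeff (f - smult ?\<alpha> g) i = 0" if "i \<ge> k" for i
  proof (cases "i = k")
    case True
    then show ?thesis using assms(1,2) leading_coeff_0_iff by fastforce
  next
    case False
    then show ?thesis using that assms by (simp add: coeff_eq_0)
  qed
qed

locale cyclic_action = matrix_action +
  fixes w :: "complex vec"
  assumes w_carrier [simp]: "w \<in> carrier_vec n"
begin

text \<open>Any polynomial of exact degree \<open>k\<close> supplies the missing direction. The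
  freedom in \<open>g\<close> allows monomials, Lanczos polynomials, and the polynomials \<lambda>q
  and \<lambda>\<lambda>q.\<close>

lemma poly_space_Suc:
  assumes "degree g = k" "g \<noteq> 0"
  shows "{act f w | f. \<forall>i\<ge>Suc k. coeff f i = 0}
    = {x + \<alpha> \<cdot>\<^sub>v act g w | x \<alpha>. x \<in> {act f w | f. \<forall>i\<ge>k. coeff f i = 0}}" (is "?l = ?r")
proof (intro equalityI subsetI)
  fix x assume "x \<in> ?l"
  then obtain f where f: "x = act f w" "\<And>i. i \<ge> Suc k \<Longrightarrow> coeff f i = 0" by auto
  obtain h \<alpha> where "f = h + smult \<alpha> g" "\<And>i. i \<ge> k \<Longrightarrow> coeff h i = 0"
    using poly_truncate[OF assms f(2)] by blast
  then show "x \<in> ?r" using f by (auto simp: act_add act_smult)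
next
  fix x assume "x \<in> ?r"
  then obtain f \<alpha> where f: "x = act f w + \<alpha> \<cdot>\<^sub>v act g w" "\<And>i. i \<ge> k \<Longrightarrow> coeff f i = 0" by auto
  then have "x = act (f + smult \<alpha> g) w" by (simp add: act_add act_smult)
  moreover have "\<forall>i\<ge>Suc k. coeff (f + smult \<alpha> g) i = 0"
    using f assms by (simp add: coeff_eq_0)
  ultimately show "x \<in> ?l" by blast
qed

lemma vec_span_act:
  assumes "\<And>i. i < k \<Longrightarrow> degree (g i) = i \<and> g i \<noteq> 0"
  shows "vec_span n ((\<lambda>i. act (g i) w) ` {..<k}) = {act f w | f. \<forall>i\<ge>k. coeff f i = 0}"
  using assms
proof (induction k)
  case 0
  have "(\<forall>i. coeff f i = 0) \<longleftrightarrow> f = 0" for f :: "complex poly"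
    by (simp add: poly_eq_iff)
  then show ?case by (simp add: vec_span_empty)
next
  case (Suc k)
  have "vec_span n ((\<lambda>i. act (g i) w) ` {..<Suc k})
      = {x + \<alpha> \<cdot>\<^sub>v act (g k) w | x \<alpha>. x \<in> vec_span n ((\<lambda>i. act (g i) w) ` {..<k})}"
    unfolding lessThan_Suc image_insert by (intro vec_span_insert) auto
  then show ?case using Suc poly_space_Suc[of "g k" k] by simp
qed

lemma krylov_eq: "krylov n k A w = {act f w | f. \<forall>i\<ge>k. coeff f i = 0}"
  using vec_span_act[of k "monom 1"]
  by (simp add: krylov_def act_pow degree_monom_eq)

end

section \<open>Invertible matrices\<close>

lemma invertible_mat_if_trivial_kernel:
  fixes B :: "'a :: field mat"
  assumes B: "B \<in> carrier_mat n n"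
    and ker: "\<And>x. x \<in> carrier_vec n \<Longrightarrow> B *\<^sub>v x = 0\<^sub>v n \<Longrightarrow> x = 0\<^sub>v n"
  shows "invertible_mat B"
proof -
  have "det B \<noteq> 0" using det_0_iff_vec_prod_zero_field[OF B] ker by blast
  then have "B \<in> Units (ring_mat TYPE('a) n ())" by (rule det_non_zero_imp_unit[OF B])
  then obtain C where "C \<in> carrier_mat n n" "C * B = 1\<^sub>m n" "B * C = 1\<^sub>m n"
    by (auto simp: Units_def ring_mat_simps)
  then show ?thesis using B
    unfolding invertible_mat_def inverts_mat_def by auto
qed

text \<open>Invertibility puts \<open>B\<close> among the units of the matrix ring, which excludes
  the result \<open>None\<close> of \<open>mat_inverse\<close>; hence \<open>the\<close> returns a
  genuine inverse.\<close>

lemma mat_inv_right: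
  assumes B: "B \<in> carrier_mat n n" and inv: "invertible_mat B"
  shows "mat_inv B \<in> carrier_mat n n" "B * mat_inv B = 1\<^sub>m n"
proof -
  obtain C where C: "B * C = 1\<^sub>m (dim_row B)" "C * B = 1\<^sub>m (dim_row C)"
    using inv unfolding invertible_mat_def inverts_mat_def by blast
  have "dim_row C = dim_col (C * B)" using C by simp
  then have r: "dim_row C = n" using B by simp
  have "dim_col (B * C) = n" using C(1) B by simp
  then have "C \<in> carrier_mat n n" using r by (intro carrier_matI) auto
  then have "B \<in> Units (ring_mat TYPE(complex) n ())"
    using B C r by (auto simp: Units_def ring_mat_simps)
  then obtain D where "mat_inverse B = Some D"
    using mat_inverse(1)[OF B, where b = "()"] by (cases "mat_inverse B") auto
  with mat_inverse(2)[OF B this]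
  show "mat_inv B \<in> carrier_mat n n" "B * mat_inv B = 1\<^sub>m n"
    by (auto simp: mat_inv_def)
qed

section \<open>Bordered Gram matrices\<close>

lemma bordered_mat_carrier [simp, intro]:
  "B \<in> carrier_mat k k \<Longrightarrow> x \<in> carrier_vec k \<Longrightarrow> bordered_mat B x d \<in> carrier_mat (Suc k) (Suc k)"
  by (auto simp: bordered_mat_def Let_def)

lemma bordered_mat_index:
  assumes "B \<in> carrier_mat k k" "x \<in> carrier_vec k" "i < Suc k" "j < Suc k"
  shows "bordered_mat B x d $$ (i, j) =
    (if i < k then if j < k then B $$ (i, j) else x $ i else if j < k then cnj (x $ j) else d)"
  using assms
  by (auto simp: bordered_mat_def Let_def mat_of_cols_def)

text \<open>The new last column is computed directly. The new last row is its conjugate, because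
  \<open>A\<close> can be moved to the other argument and the inner product is Hermitian.\<close>

lemma gram_append_cols:
  assumes M: "hermitian_pos_def n M" and A: "self_adjoint_wrt n M A"
    and X: "X \<in> carrier_mat n k" and v: "v \<in> carrier_vec n"
  shows "gram M (append_cols X [v]) (A * append_cols X [v])
    = bordered_mat (gram M X (A * X)) (gram_vec M X (A *\<^sub>v v)) (ip M v (A *\<^sub>v v))"
proof (rule eq_matI)
  let ?Y = "append_cols X [v]"
  have Mc: "M \<in> carrier_mat n n" and Ac: "A \<in> carrier_mat n n"
    using M A by (auto simp: hermitian_pos_def_def self_adjoint_wrt_def)
  have B: "gram M X (A * X) \<in> carrier_mat k k" "gram_vec M X (A *\<^sub>v v) \<in> carrier_vec k"
    using Ac X by (auto intro!: carrier_vecI)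
  fix i j assume "i < dim_row (bordered_mat (gram M X (A * X)) (gram_vec M X (A *\<^sub>v v)) (ip M v (A *\<^sub>v v)))"
    "j < dim_col (bordered_mat (gram M X (A * X)) (gram_vec M X (A *\<^sub>v v)) (ip M v (A *\<^sub>v v)))"
  then have ij: "i < Suc k" "j < Suc k" using carrier_matD[OF bordered_mat_carrier[OF B]] by simp_all
  have Y: "?Y \<in> carrier_mat n (Suc k)" using X by auto
  have c: "col X l \<in> carrier_vec n" for l using X by auto
  have Av: "A *\<^sub>v x \<in> carrier_vec n" if "x \<in> carrier_vec n" for x
    using Ac that by (rule mult_mat_vec_carrier)
  have "ip M v (A *\<^sub>v col X j) = ip M (A *\<^sub>v v) (col X j)"
    using A v c by (simp add: self_adjoint_wrt_def)
  also have "\<dots> = cnj (ip M (col X j) (A *\<^sub>v v))"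
    using M c Av v by (intro ip_cnj) auto
  finally have sym: "ip M v (A *\<^sub>v col X j) = cnj (ip M (col X j) (A *\<^sub>v v))" .
  have AX: "A * X \<in> carrier_mat n k" "A * ?Y \<in> carrier_mat n (Suc k)" using Ac X Y by auto
  have "gram M ?Y (A * ?Y) $$ (i, j) = ip M (col ?Y i) (A *\<^sub>v col ?Y j)"
    using Mc Y AX ij by (subst gram_index) (auto simp: col_mult2[OF Ac Y])
  then show "gram M ?Y (A * ?Y) $$ (i, j)
      = bordered_mat (gram M X (A * X)) (gram_vec M X (A *\<^sub>v v)) (ip M v (A *\<^sub>v v)) $$ (i, j)"
    using ij X v Av[OF v] AX sym
    by (auto simp: bordered_mat_index[OF B] col_append_cols gram_index[OF Mc X AX(1)]
        gram_vec_index[OF Mc X] col_mult2[OF Ac X])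
qed (use assms in \<open>auto simp: bordered_mat_def Let_def self_adjoint_wrt_def\<close>)

lemma gram_append_cols_one:
  assumes M: "hermitian_pos_def n M"
    and X: "X \<in> carrier_mat n k" "gram M X X = 1\<^sub>m k"
    and v: "v \<in> carrier_vec n" "ip M v v = 1" "gram_vec M X v = 0\<^sub>v k"
  shows "gram M (append_cols X [v]) (append_cols X [v]) = 1\<^sub>m (Suc k)"
proof (rule eq_matI)
  let ?Y = "append_cols X [v]"
  have Mc: "M \<in> carrier_mat n n" using M by (simp add: hermitian_pos_def_def)
  fix i j assume "i < dim_row (1\<^sub>m (Suc k) :: complex mat)" "j < dim_col (1\<^sub>m (Suc k) :: complex mat)"
  then have ij: "i < Suc k" "j < Suc k" by auto
  have Y: "?Y \<in> carrier_mat n (Suc k)" using X by auto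
  have c: "col X l \<in> carrier_vec n" for l using X by auto
  have 0: "ip M (col X l) v = 0" if "l < k" for l
    using gram_vec_index[OF Mc X(1) v(1) that] v(3) that by simp
  then have 1: "ip M v (col X l) = 0" if "l < k" for l
    using ip_cnj[OF M v(1) c[of l]] that by simp
  have 2: "ip M (col X i) (col X j) = (if i = j then 1 else 0)" if "i < k" "j < k"
    using gram_index[OF Mc X(1) X(1) that] X(2) that by simp
  show "gram M ?Y ?Y $$ (i, j) = 1\<^sub>m (Suc k) $$ (i, j)"
    using ij X v 0 1 2
    by (auto simp: gram_index[OF Mc Y Y] col_append_cols less_Suc_eq)
qed (use assms in auto)

section \<open>The Lanczos process\<close>

locale lanczos_process = cyclic_action +
  fixes M :: "complex mat" and m :: nat and p :: "nat \<Rightarrow> real poly" and a b :: "nat \<Rightarrow> real"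
  assumes M: "hermitian_pos_def n M" and A: "self_adjoint_wrt n M A"
    and lanczos: "lanczos_data M A w m p a b"
begin

definition P :: "nat \<Rightarrow> complex poly" where
  "P j = map_poly complex_of_real (p j)"

abbreviation e :: "nat \<Rightarrow> complex vec" where
  "e j \<equiv> act (P j) w"

abbreviation K :: "nat \<Rightarrow> complex vec set" where
  "K k \<equiv> krylov n k A w"

lemma M_carrier [simp]: "M \<in> carrier_mat n n"
  using M by (simp add: hermitian_pos_def_def)

lemma lanczos_vec_eq: "lanczos_vec A w p j = e (j - 1)"
  by (simp add: lanczos_vec_def act_def P_def)

lemma degree_P [simp]: "j \<le> m \<Longrightarrow> degree (P j) = j"
  using lanczos by (simp add: lanczos_data_def P_def)

lemma P_nonzero [simp]: "j \<le> m \<Longrightarrow> P j \<noteq> 0"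
  using lanczos by (auto simp: lanczos_data_def P_def)

lemma ip_e: "i \<le> m \<Longrightarrow> j \<le> m \<Longrightarrow> ip M (e i) (e j) = (if i = j then 1 else 0)"
  using lanczos by (simp add: lanczos_data_def act_def P_def)

lemma K_carrier: "x \<in> K k \<Longrightarrow> x \<in> carrier_vec n"
  by (auto simp: krylov_eq)

lemma K_Suc: "k \<le> m \<Longrightarrow> K (Suc k) = {x + \<alpha> \<cdot>\<^sub>v e k | x \<alpha>. x \<in> K k}"
  using poly_space_Suc[of "P k" k] by (simp add: krylov_eq)

lemma e_in_K: "j < k \<Longrightarrow> j \<le> m \<Longrightarrow> e j \<in> K k"
  unfolding krylov_eq by (auto intro!: exI[of _ "P j"] simp: coeff_eq_0)

text \<open>Multiplication by \<open>A\<close> is multiplication of the polynomial by \<lambda>,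
  which shifts its coefficients by one place.\<close>

lemma A_K: "x \<in> K k \<Longrightarrow> A *\<^sub>v x \<in> K (Suc k)"
proof -
  assume "x \<in> K k"
  then obtain f where "x = act f w" "\<forall>i\<ge>k. coeff f i = 0" by (auto simp: krylov_eq)
  then have "A *\<^sub>v x = act (pCons 0 f) w" "\<forall>i\<ge>Suc k. coeff (pCons 0 f) i = 0"
    by (auto simp: act_shift coeff_pCons split: nat.split)
  then show ?thesis unfolding krylov_eq by blast
qed

text \<open>By induction, each enlargement of the Krylov space adds a multiple of \<open>e k\<close>
  with \<open>k < j\<close>, which is orthogonal to \<open>e j\<close>.\<close>

lemma K_orthogonal_right: "x \<in> K k \<Longrightarrow> k \<le> j \<Longrightarrow> j \<le> m \<Longrightarrow> ip M (e j) x = 0"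
proof (induction k arbitrary: x)
  case 0
  then obtain f where "x = act f w" "\<forall>i. coeff f i = 0" by (auto simp: krylov_eq)
  moreover from this have "f = 0" by (simp add: poly_eq_iff)
  ultimately show ?case by (simp add: ip_zero_right[of _ n])
next
  case (Suc k)
  then obtain y \<alpha> where "x = y + \<alpha> \<cdot>\<^sub>v e k" "y \<in> K k" by (auto simp: K_Suc)
  with Suc show ?case
    using K_carrier[of y k] by (simp add: ip_add_right[of _ n] ip_smult_right[of _ n] ip_e)
qed

lemma K_orthogonal: "x \<in> K k \<Longrightarrow> k \<le> j \<Longrightarrow> j \<le> m \<Longrightarrow> ip M x (e j) = 0"
  using K_orthogonal_right[of x k j] ip_cnj[OF M, of x "e j"] K_carrier[of x k] by simp

text \<open>By orthonormality, the leading coefficient of \<open>f\<close> can be read off \<open>f(A) w\<close>.\<close>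

lemma act_eq_0_iff:
  assumes "degree f \<le> m"
  shows "act f w = 0\<^sub>v n \<longleftrightarrow> f = 0"
proof
  assume f: "act f w = 0\<^sub>v n"
  let ?d = "degree f"
  have "coeff f i = 0" if "i \<ge> Suc ?d" for i using that by (simp add: coeff_eq_0)
  \<comment> \<open>Here \<open>h\<close> has no coefficient at \<open>?d\<close> or above. Pairing
    with \<open>e ?d\<close> removes \<open>h\<close> and shows that \<open>\<alpha>\<close> is
    zero, so \<open>f = h\<close> loses its own leading coefficient.\<close>
  then obtain h \<alpha> where h: "f = h + smult \<alpha> (P ?d)" "\<And>i. i \<ge> ?d \<Longrightarrow> coeff h i = 0"
    using poly_truncate[of "P ?d" ?d f] assms by auto
  have hK: "act h w \<in> K ?d" using h(2) by (auto simp: krylov_eq)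
  have "0 = ip M (e ?d) (0\<^sub>v n)" by (simp add: ip_zero_right[of _ n])
  also have "\<dots> = ip M (e ?d) (act h w + \<alpha> \<cdot>\<^sub>v e ?d)"
    using f h(1) act_add[of w h "smult \<alpha> (P ?d)"] by (simp add: act_smult)
  also have "\<dots> = \<alpha>"
    using K_orthogonal_right[OF hK] assms
    by (simp add: ip_add_right[of _ n] ip_smult_right[of _ n] ip_e)
  finally have "f = h" using h(1) by simp
  then have "coeff f ?d = 0" using h(2) by simp
  then show "f = 0" by simp
qed simp

lemma ip_A: "x \<in> carrier_vec n \<Longrightarrow> y \<in> carrier_vec n \<Longrightarrow> ip M (A *\<^sub>v x) y = ip M x (A *\<^sub>v y)"
  using A by (simp add: self_adjoint_wrt_def)

text \<open>This is the three-term recurrence with index \<open>Suc j\<close>, applied to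
  \<open>w\<close>: \<open>e j\<close> counts from 0, while \<open>a\<close> and \<open>b\<close>
  count from 1. For \<open>j = 0\<close> the term of the polynomial with index -1 drops out.\<close>

lemma A_e:
  assumes "j < m"
  shows "A *\<^sub>v e j = (if j = 0 then 0\<^sub>v n else complex_of_real (b j) \<cdot>\<^sub>v e (j - 1))
    + complex_of_real (a (Suc j)) \<cdot>\<^sub>v e j + complex_of_real (b (Suc j)) \<cdot>\<^sub>v e (Suc j)"
proof -
  have "[:0, 1:] * p j = (if j = 0 then 0 else smult (b j) (p (j - 1)))
      + smult (a (Suc j)) (p j) + smult (b (Suc j)) (p (Suc j))"
    using lanczos assms unfolding lanczos_data_def
    by (auto dest!: bspec[of _ _ "Suc j"] simp: numeral_2_eq_2)
  then have "map_poly complex_of_real ([:0, 1:] * p j)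
      = map_poly complex_of_real ((if j = 0 then 0 else smult (b j) (p (j - 1)))
        + smult (a (Suc j)) (p j) + smult (b (Suc j)) (p (Suc j)))" by simp
  then have "pCons 0 (P j) = (if j = 0 then 0 else smult (complex_of_real (b j)) (P (j - 1)))
      + smult (complex_of_real (a (Suc j))) (P j) + smult (complex_of_real (b (Suc j))) (P (Suc j))"
    by (auto simp: P_def of_real_hom.map_poly_pCons_hom of_real_hom.map_poly_hom_add
      of_real_hom.map_poly_hom_smult split: if_splits)
  then have "act (pCons 0 (P j)) w
    = act ((if j = 0 then 0 else smult (complex_of_real (b j)) (P (j - 1)))
      + smult (complex_of_real (a (Suc j))) (P j) + smult (complex_of_real (b (Suc j))) (P (Suc j))) w"
    by simp
  then show ?thesis by (auto simp: act_shift act_add act_smult split: if_splits)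
qed

lemma ip_A_e:
  assumes "i \<le> m" "j < m"
  shows "ip M (e i) (A *\<^sub>v e j) = (if i = j then complex_of_real (a (Suc j))
    else if i = Suc j then complex_of_real (b (Suc j))
    else if j = Suc i then complex_of_real (b j) else 0)"
proof -
  show ?thesis
    using assms
    by (auto simp: A_e ip_add_right[of _ n] ip_smult_right[of _ n] ip_e ip_zero_right[of _ n])
qed

lemma lanczos_basis_carrier [simp]: "lanczos_basis n A w p k \<in> carrier_mat n k"
  unfolding lanczos_basis_def by (intro carrier_matI) auto

lemma col_lanczos_basis: "j < k \<Longrightarrow> col (lanczos_basis n A w p k) j = e j"
  unfolding lanczos_basis_def
  by (subst col_mat_of_cols) (auto simp: lanczos_vec_eq simp del: upt_Suc)

lemma col_space_lanczos_basis:
  assumes "k \<le> m"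
  shows "vec_space.col_space n (lanczos_basis n A w p k) = K k"
proof -
  have "cols (lanczos_basis n A w p k) = map (lanczos_vec A w p) [1..<Suc k]"
    unfolding lanczos_basis_def by (intro cols_mat_of_cols) (auto simp: lanczos_vec_eq)
  moreover have "lanczos_vec A w p ` {1..<Suc k} = e ` {..<k}"
    by (force simp: lanczos_vec_eq image_iff Bex_def intro: exI[of _ "Suc _"])
  ultimately have "set (cols (lanczos_basis n A w p k)) = e ` {..<k}" by (simp del: upt_Suc)
  then show ?thesis
    using vec_span_act[of k P] assms by (simp flip: vec_span_set_cols add: krylov_eq)
qed

lemma gram_lanczos_basis:
  assumes "k \<le> m"
  shows "gram M (lanczos_basis n A w p k) (lanczos_basis n A w p k) = 1\<^sub>m k"
proof (rule eq_matI)
  have V: "lanczos_basis n A w p k \<in> carrier_mat n k" by simp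
  fix i j assume "i < dim_row (1\<^sub>m k :: complex mat)" "j < dim_col (1\<^sub>m k :: complex mat)"
  then show "gram M (lanczos_basis n A w p k) (lanczos_basis n A w p k) $$ (i, j) = 1\<^sub>m k $$ (i, j)"
    using assms by (simp add: gram_index[OF M_carrier V V] col_lanczos_basis ip_e)
qed (use carrier_matD[OF lanczos_basis_carrier[of k]] in auto)

end

section \<open>Extending an orthonormal basis by two Lanczos vectors\<close>

locale krylov_extension = lanczos_process +
  fixes U :: "complex mat" and r :: nat
  assumes m_eq: "m = Suc (Suc r)" and U: "U \<in> carrier_mat n r" "gram M U U = 1\<^sub>m r"
    and U_space: "vec_space.col_space n U = K r"
begin

section \<open>The bases of the two enlarged Krylov spaces and their Rayleigh quotients\<close>

definition X :: "complex mat" where "X = append_cols U [e r]"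

definition Y :: "complex mat" where "Y = append_cols X [e (Suc r)]"

text \<open>With \<open>r = m - 2\<close>, the vectors \<open>e r\<close> and
  \<open>e (Suc r)\<close> are the Lanczos vectors number m-1 and m, so \<open>G\<close> is the
  Rayleigh quotient of size m-1 that becomes \<open>Am1\<close> in the theorem.\<close>

definition G :: "complex mat" where "G = gram M X (A * X)"

lemma m_bounds [simp]: "r \<le> m" "Suc r \<le> m" "r < m" "Suc r < m"
  by (simp_all add: m_eq)

lemma X_carrier [simp]: "X \<in> carrier_mat n (Suc r)"
  using append_cols_carrier[OF U(1), of "[e r]"] by (simp add: X_def)

lemma Y_carrier [simp]: "Y \<in> carrier_mat n (Suc (Suc r))"
  using append_cols_carrier[OF X_carrier, of "[e (Suc r)]"] by (simp add: Y_def)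

lemma X_space: "vec_space.col_space n X = K (Suc r)"
  unfolding X_def by (subst col_space_append_cols[OF U(1)]) (auto simp: U_space K_Suc)

lemma Y_space: "vec_space.col_space n Y = K (Suc (Suc r))"
  unfolding Y_def by (subst col_space_append_cols[OF X_carrier]) (auto simp: X_space K_Suc)

lemma gram_vec_U_e: "r \<le> j \<Longrightarrow> j \<le> m \<Longrightarrow> gram_vec M U (e j) = 0\<^sub>v r"
  using U_space K_orthogonal[of _ r j] by (intro gram_vec_orthogonal[OF M_carrier U(1)]) auto

lemma gram_vec_X_e: "gram_vec M X (e (Suc r)) = 0\<^sub>v (Suc r)"
  using X_space K_orthogonal[of _ "Suc r" "Suc r"]
  by (intro gram_vec_orthogonal[OF M_carrier X_carrier]) auto

lemma X_one: "gram M X X = 1\<^sub>m (Suc r)"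
  unfolding X_def by (rule gram_append_cols_one[OF M U]) (simp_all add: ip_e gram_vec_U_e)

lemma Y_one: "gram M Y Y = 1\<^sub>m (Suc (Suc r))"
  unfolding Y_def by (rule gram_append_cols_one[OF M X_carrier X_one]) (simp_all add: ip_e gram_vec_X_e)

lemma col_U_K: "j < r \<Longrightarrow> col U j \<in> K r"
  unfolding U_space[symmetric] col_space_eq_image[OF U(1)]
  using mult_unit_vec[OF U(1)] by (intro image_eqI[of _ _ "unit_vec r j"]) auto

lemma col_X: "j < Suc r \<Longrightarrow> col X j = (if j < r then col U j else e r)"
  using U(1) by (auto simp: X_def col_append_cols)

lemma col_Y: "j < Suc (Suc r) \<Longrightarrow> col Y j = (if j < r then col U j else e j)"
  using X_carrier unfolding Y_def by (subst col_append_cols) 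
    (auto simp: col_X not_less less_Suc_eq simp del: X_carrier)

lemma G_carrier [simp]: "G \<in> carrier_mat (Suc r) (Suc r)"
  unfolding G_def by (intro gram_carrier[of _ n] mult_carrier_mat[of _ n n]) auto

lemma G_eq:
  "G = bordered_mat (gram M U (A * U)) (gram_vec M U (A *\<^sub>v e r)) (complex_of_real (a (Suc r)))"
  unfolding G_def X_def by (subst gram_append_cols[OF M A U(1)]) (simp_all add: ip_A_e)

text \<open>Moving \<open>A\<close> to a column of \<open>U\<close> gives an element of
  \<open>K (Suc r)\<close>, which is orthogonal to \<open>e (Suc r)\<close>. Only the entry
  belonging to \<open>e r\<close> survives, and the recurrence gives its value.\<close>

lemma gram_vec_X_A_e:
  "gram_vec M X (A *\<^sub>v e (Suc r)) = complex_of_real (b (Suc r)) \<cdot>\<^sub>v unit_vec (Suc r) r"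
proof (rule eq_vecI)
  fix i assume "i < dim_vec (complex_of_real (b (Suc r)) \<cdot>\<^sub>v unit_vec (Suc r) r)"
  then have i: "i < Suc r" by simp
  have "ip M (col U i) (A *\<^sub>v e (Suc r)) = 0" if "i < r"
  proof -
    have "ip M (A *\<^sub>v col U i) (e (Suc r)) = 0"
      using A_K[OF col_U_K[OF that]] by (intro K_orthogonal) auto
    then show ?thesis using U(1) that by (simp add: ip_A)
  qed
  moreover have "ip M (e r) (A *\<^sub>v e (Suc r)) = complex_of_real (b (Suc r))"
    by (simp add: ip_A_e)
  ultimately show "gram_vec M X (A *\<^sub>v e (Suc r)) $ i
      = (complex_of_real (b (Suc r)) \<cdot>\<^sub>v unit_vec (Suc r) r) $ i"
    using i by (auto simp: gram_vec_index[OF M_carrier X_carrier] col_X less_Suc_eq)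
qed (use carrier_matD[OF X_carrier] in simp)

lemma gram_Y:
  "gram M Y (A * Y) = bordered_mat G (complex_of_real (b (Suc r)) \<cdot>\<^sub>v unit_vec (Suc r) r)
    (complex_of_real (a m))"
  unfolding Y_def G_def
  by (subst gram_append_cols[OF M A X_carrier]) (simp_all add: ip_A_e gram_vec_X_A_e m_eq)

text \<open>\<open>A *\<^sub>v z\<close> lies one Krylov step higher. Its part in
  \<open>K (Suc r)\<close> is recovered by projection with \<open>X\<close>, and the rest is a
  multiple of \<open>e (Suc r)\<close>.\<close>

lemma A_mult_K:
  assumes z: "z \<in> K (Suc r)"
  shows "A *\<^sub>v z = X *\<^sub>v gram_vec M X (A *\<^sub>v z) + ip M (e (Suc r)) (A *\<^sub>v z) \<cdot>\<^sub>v e (Suc r)"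
proof -
  obtain x \<gamma> where x: "A *\<^sub>v z = x + \<gamma> \<cdot>\<^sub>v e (Suc r)" "x \<in> K (Suc r)"
    using A_K[OF z] by (auto simp: K_Suc)
  then have "gram_vec M X (A *\<^sub>v z) = gram_vec M X x"
    using K_carrier[OF x(2)]
    by (intro eq_vecI) (auto simp: gram_vec_add[OF M_carrier X_carrier] gram_vec_smult[OF M_carrier X_carrier]
      gram_vec_X_e carrier_matD[OF X_carrier])
  moreover have "X *\<^sub>v gram_vec M X x = x"
    using project_col_space[OF M_carrier X_carrier X_one] x X_space by simp
  moreover have "ip M (e (Suc r)) (A *\<^sub>v z) = \<gamma>"
    using x K_carrier[OF x(2)] K_orthogonal_right[OF x(2)]
    by (simp add: ip_add_right[of _ n] ip_smult_right[of _ n] ip_e)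
  ultimately show ?thesis using x by simp
qed

text \<open>
  A vector \<open>y\<close> represents \<open>f(A) w\<close> with \<open>deg f \<le> r\<close>, and the hypothesis on \<open>y\<close> says that
  \<open>(\<lambda> - \<xi>) f = \<delta> p\<^sub>r + \<beta>\<^sub>r\<^sub>+\<^sub>1 y\<^sub>r p\<^sub>r\<^sub>+\<^sub>1\<close>. Evaluating at \<open>\<xi>\<close> gives the first claim.
\<close>

lemma G_shifted:
  assumes y: "y \<in> carrier_vec (Suc r)"
    and G: "G *\<^sub>v y = \<xi> \<cdot>\<^sub>v y + \<delta> \<cdot>\<^sub>v unit_vec (Suc r) r"
    and \<xi>: "poly (P (Suc r)) \<xi> \<noteq> 0"
  shows "complex_of_real (b (Suc r)) * y $ r = - \<delta> * poly (P r) \<xi> / poly (P (Suc r)) \<xi>"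
    and "\<delta> = 0 \<Longrightarrow> y = 0\<^sub>v (Suc r)"
proof -
  define z where "z = X *\<^sub>v y"
  let ?\<beta> = "complex_of_real (b (Suc r))"
  have zK: "z \<in> K (Suc r)"
    using y by (auto simp: z_def X_space[symmetric] col_space_eq_image[OF X_carrier])
  note zc = K_carrier[OF zK]
  have gz: "gram_vec M X z = y"
    using y by (simp add: z_def gram_vec_mult[OF M_carrier X_carrier X_carrier] X_one)
  have "A *\<^sub>v z = (A * X) *\<^sub>v y" using y by (simp add: z_def assoc_mult_mat_vec[of _ n n _ "Suc r"])
  then have gA: "gram_vec M X (A *\<^sub>v z) = G *\<^sub>v y"
    using y gram_vec_mult[OF M_carrier X_carrier mult_carrier_mat[OF A_carrier X_carrier] y]
    by (simp add: G_def)
  have Xe: "X *\<^sub>v unit_vec (Suc r) r = e r"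
    using mult_unit_vec[OF X_carrier, of r] by (simp add: col_X)
  obtain f where f: "z = act f w" "\<forall>i\<ge>Suc r. coeff f i = 0"
    using zK by (auto simp: krylov_eq)
  have er: "ip M (e r) z = y $ r"
    using gz gram_vec_index[OF M_carrier X_carrier zc, of r] by (simp add: col_X)
  \<comment> \<open>The coefficient of \<open>A z\<close> along \<open>e (Suc r)\<close> is found by
    moving \<open>A\<close> to \<open>e (Suc r)\<close> and expanding there. As \<open>z\<close> is
    orthogonal to \<open>e (Suc r)\<close> and \<open>e m\<close>, only the \<open>e r\<close> term
    remains, and pairing \<open>e r\<close> with \<open>z\<close> gives the last coordinate of
    \<open>y\<close>.\<close>
  have "ip M (e (Suc r)) (A *\<^sub>v z) = ip M (A *\<^sub>v e (Suc r)) z"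
    using zc by (simp add: ip_A)
  also have "\<dots> = cnj (ip M z (A *\<^sub>v e (Suc r)))"
    using zc by (intro ip_cnj[OF M]) auto
  also have "ip M z (A *\<^sub>v e (Suc r)) = ?\<beta> * ip M z (e r)"
    using zc K_orthogonal[OF zK, of "Suc r"] K_orthogonal[OF zK, of "Suc (Suc r)"]
    by (simp add: A_e ip_add_right[of _ n] ip_smult_right[of _ n] m_eq)
  also have "cnj (?\<beta> * ip M z (e r)) = ?\<beta> * y $ r"
    using er ip_cnj[OF M, of "e r" z] zc by simp
  finally have "A *\<^sub>v z = X *\<^sub>v (\<xi> \<cdot>\<^sub>v y + \<delta> \<cdot>\<^sub>v unit_vec (Suc r) r) + (?\<beta> * y $ r) \<cdot>\<^sub>v e (Suc r)"
    using A_mult_K[OF zK] gA G by simp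
  also have "X *\<^sub>v (\<xi> \<cdot>\<^sub>v y + \<delta> \<cdot>\<^sub>v unit_vec (Suc r) r) = \<xi> \<cdot>\<^sub>v z + \<delta> \<cdot>\<^sub>v e r"
    using y Xe by (simp add: mult_add_distrib_mat_vec[OF X_carrier] mult_mat_vec[OF X_carrier] z_def)
  finally have Az: "act (pCons 0 f) w
      = act (smult \<xi> f + smult \<delta> (P r) + smult (?\<beta> * y $ r) (P (Suc r))) w"
    by (simp add: act_shift act_add act_smult f)
  \<comment> \<open>The two sides of the vector equation are compared as polynomials: their
    difference has degree at most \<open>m\<close> and annihilates \<open>w\<close>, hence is
    zero.\<close>
  define h where "h = pCons 0 f - (smult \<xi> f + smult \<delta> (P r) + smult (?\<beta> * y $ r) (P (Suc r)))"
  have df: "degree f \<le> r" using f(2) by (intro degree_le) auto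
  have "degree h \<le> m"
    unfolding h_def using df
    by (intro degree_diff_le degree_add_le) (auto simp: m_eq intro: order.trans[OF degree_pCons_le] order.trans[OF degree_smult_le])
  moreover have "act h w = 0\<^sub>v n"
    unfolding h_def by (subst act_diff) (simp_all add: Az minus_cancel_vec[of _ n])
  ultimately have "h = 0" by (simp add: act_eq_0_iff)
  then have eq: "[:- \<xi>, 1:] * f = smult \<delta> (P r) + smult (?\<beta> * y $ r) (P (Suc r))"
    by (simp add: h_def algebra_simps)
  \<comment> \<open>At \<open>\<xi>\<close> the linear factor vanishes, which removes the unknown
    polynomial \<open>f\<close>.\<close>
  then have "poly ([:- \<xi>, 1:] * f) \<xi> = poly (smult \<delta> (P r) + smult (?\<beta> * y $ r) (P (Suc r))) \<xi>"
    by (rule arg_cong)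
  then have "0 = \<delta> * poly (P r) \<xi> + ?\<beta> * y $ r * poly (P (Suc r)) \<xi>" by simp
  then show 1: "?\<beta> * y $ r = - \<delta> * poly (P r) \<xi> / poly (P (Suc r)) \<xi>"
    using \<xi> by (simp add: field_simps eq_neg_iff_add_eq_0)
  show "y = 0\<^sub>v (Suc r)" if "\<delta> = 0"
  proof -
    \<comment> \<open>For \<open>\<delta> = 0\<close> the first claim also kills the coefficient of
      \<open>P (Suc r)\<close>, so the whole right-hand side is zero. There are no zero divisors, so
      \<open>f\<close> vanishes.\<close>
    have "[:- \<xi>, 1:] * f = 0" using eq 1 that by simp
    then have "f = 0" by (metis mult_eq_0_iff one_neq_zero pCons_eq_0_iff)
    then have "z = 0\<^sub>v n" using f by simp
    then show ?thesis using gz gram_vec_mult[OF M_carrier X_carrier X_carrier, of "0\<^sub>v (Suc r)"]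
      by (simp add: mult_mat_vec_zero[OF X_carrier] X_one)
  qed
qed

section \<open>Orthogonalization starting from \<open>A u\<close>, and when the extension is
  direct\<close>

lemma ip_norm_e: "0 \<le> \<gamma> \<Longrightarrow> j \<le> m \<Longrightarrow> ip_norm M (complex_of_real \<gamma> \<cdot>\<^sub>v e j) = \<gamma>"
  by (simp add: ip_norm_def ip_smult_left[of _ n] ip_smult_right[of _ n] ip_e real_sqrt_mult)

text \<open>
  The basis vectors are determined up to sign by the subspaces only; the sign is fixed by the
  positive leading coefficients of \<open>\<lambda> q\<close> and \<open>p\<^sub>r\<close>.
\<close>

lemma extend_orthonormal_basis_eq:
  assumes q: "degree q = r - 1" "lead_coeff q = 1" and r: "0 < r"
  shows "extend_orthonormal_basis M A (act q w) U =
    (e r, e (Suc r), gram_vec M U (A *\<^sub>v e r) @\<^sub>v vec 1 (\<lambda>_. complex_of_real (a (Suc r))),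
     b (Suc r), complex_of_real (a m))"
proof -
  let ?u = "act q w"
  \<comment> \<open>Since \<open>q\<close> is monic of degree \<open>r - 1\<close>, this factor
    makes the coefficients at \<open>r\<close> of \<lambda>q and \<open>\<alpha>\<close> times
    \<open>P r\<close> agree. It is positive, so normalizing yields \<open>e r\<close> itself and
    not its negative.\<close>
  define \<alpha> where "\<alpha> = 1 / lead_coeff (p r)"
  have lead: "0 < lead_coeff (p r)" "degree (p r) = r"
    using lanczos m_bounds(1) unfolding lanczos_data_def by blast+
  then have \<alpha>: "0 < \<alpha>" by (simp add: \<alpha>_def)
  define h where "h = pCons 0 q - smult (complex_of_real \<alpha>) (P r)"
  have "coeff h i = 0" if "i \<ge> r" for i
  proof (cases "i = r")
    case True
    then show ?thesis using lead q r by (cases r) (auto simp: h_def \<alpha>_def P_def coeff_map_poly)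
  next
    case False
    then show ?thesis using that q r
      by (cases i) (auto simp: h_def coeff_eq_0 coeff_pCons intro!: coeff_eq_0)
  qed
  then have hK: "act h w \<in> K r" by (auto simp: krylov_eq)
  have "pCons 0 q = h + smult (complex_of_real \<alpha>) (P r)" by (simp add: h_def)
  then have Au: "A *\<^sub>v ?u = act h w + complex_of_real \<alpha> \<cdot>\<^sub>v e r"
    by (simp add: act_add act_smult flip: act_shift)
  have "gram_vec M U (A *\<^sub>v ?u) = gram_vec M U (act h w)"
    using U(1) by (intro eq_vecI)
      (auto simp: Au gram_vec_add[OF M_carrier U(1)] gram_vec_smult[OF M_carrier U(1)] gram_vec_U_e)
  moreover have "U *\<^sub>v gram_vec M U (act h w) = act h w"
    using project_col_space[OF M_carrier U] hK U_space by simp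
  ultimately have 1: "A *\<^sub>v ?u - U *\<^sub>v gram_vec M U (A *\<^sub>v ?u) = complex_of_real \<alpha> \<cdot>\<^sub>v e r"
    using K_carrier[OF hK] by (intro eq_vecI) (auto simp: Au carrier_vecD[OF act_carrier])
  have 2: "complex_of_real (1 / \<alpha>) \<cdot>\<^sub>v (complex_of_real \<alpha> \<cdot>\<^sub>v e r) = e r"
    using \<alpha> by (simp add: smult_smult_assoc flip: of_real_mult)
  have 3: "gram_vec M X (A *\<^sub>v e r)
      = gram_vec M U (A *\<^sub>v e r) @\<^sub>v vec 1 (\<lambda>_. complex_of_real (a (Suc r)))"
    using U(1) carrier_matD[OF X_carrier]
    by (intro eq_vecI) (auto simp: gram_vec_index[OF M_carrier X_carrier]
      gram_vec_index[OF M_carrier U(1)] col_X less_Suc_eq ip_A_e)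
  have bpos: "0 < b (Suc r)" using lanczos by (simp add: lanczos_data_def)
  \<comment> \<open>The second step needs no comparison of polynomials: the part of
    \<open>A e r\<close> outside the range of \<open>X\<close> is already a positive multiple of
    \<open>e (Suc r)\<close>.\<close>
  have A_e_r: "A *\<^sub>v e r = X *\<^sub>v gram_vec M X (A *\<^sub>v e r) + complex_of_real (b (Suc r)) \<cdot>\<^sub>v e (Suc r)"
    using A_mult_K[of "e r"] e_in_K[of r "Suc r"] by (simp add: ip_A_e)
  have "x + y - x = y" if "x \<in> carrier_vec n" "y \<in> carrier_vec n" for x y :: "complex vec"
    using that by (intro eq_vecI) auto
  moreover have "X *\<^sub>v gram_vec M X (A *\<^sub>v e r) \<in> carrier_vec n"
    using mult_mat_vec_carrier[OF X_carrier] carrier_matD[OF X_carrier] by (metis carrier_vecI dim_gram_vec)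
  ultimately have 4: "A *\<^sub>v e r - X *\<^sub>v gram_vec M X (A *\<^sub>v e r)
      = complex_of_real (b (Suc r)) \<cdot>\<^sub>v e (Suc r)"
    using A_e_r by (metis act_carrier smult_carrier_vec w_carrier)
  have 5: "complex_of_real (1 / b (Suc r)) \<cdot>\<^sub>v (complex_of_real (b (Suc r)) \<cdot>\<^sub>v e (Suc r)) = e (Suc r)"
    using bpos by (simp add: smult_smult_assoc flip: of_real_mult)
  have 6: "ip_norm M (complex_of_real \<alpha> \<cdot>\<^sub>v e r) = \<alpha>"
    "ip_norm M (complex_of_real (b (Suc r)) \<cdot>\<^sub>v e (Suc r)) = b (Suc r)"
    using \<alpha> bpos by (simp_all add: ip_norm_e)
  have 7: "ip M (e (Suc r)) (A *\<^sub>v e (Suc r)) = complex_of_real (a m)"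
    by (simp add: ip_A_e m_eq)
  show ?thesis
    unfolding extend_orthonormal_basis_def Let_def 1 6 2 X_def[symmetric] 4 5 3[symmetric] 7 ..
qed

text \<open>The polynomials \<lambda>q and \<lambda>\<lambda>q have exact degrees \<open>r\<close>
  and \<open>Suc r\<close>, so they extend \<open>K r\<close> to \<open>K m\<close>. For the
  intersection, comparing coefficients at \<open>Suc r\<close> and then at \<open>r\<close> forces
  both multipliers to vanish.\<close>

lemma krylov_direct_sum:
  assumes q: "degree q = r - 1" "q \<noteq> 0" and r: "0 < r"
  shows "is_direct_sum n (K m) (K r) (vec_span n {A *\<^sub>v act q w, A *\<^sub>v (A *\<^sub>v act q w)})"
proof -
  define g where "g = pCons 0 q"
  have g: "degree g = r" "g \<noteq> 0" using q r by (auto simp: g_def)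
  then have g': "degree (pCons 0 g) = Suc r" "pCons 0 g \<noteq> 0" by auto
  have act: "A *\<^sub>v act q w = act g w" "A *\<^sub>v (A *\<^sub>v act q w) = act (pCons 0 g) w"
    by (simp_all add: act_shift g_def)
  have span: "vec_span n {act g w, act (pCons 0 g) w}
      = {\<alpha> \<cdot>\<^sub>v act g w + \<gamma> \<cdot>\<^sub>v act (pCons 0 g) w | \<alpha> \<gamma>. True}"
    by (intro vec_span_pair) auto
  have "K m = {x + \<gamma> \<cdot>\<^sub>v act (pCons 0 g) w | x \<gamma>. x \<in> K (Suc r)}"
    using poly_space_Suc[OF g'] by (simp add: krylov_eq m_eq)
  also have "K (Suc r) = {x + \<alpha> \<cdot>\<^sub>v act g w | x \<alpha>. x \<in> K r}"
    using poly_space_Suc[OF g] by (simp add: krylov_eq)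
  finally have "K m = {x + \<alpha> \<cdot>\<^sub>v act g w + \<gamma> \<cdot>\<^sub>v act (pCons 0 g) w | x \<alpha> \<gamma>. x \<in> K r}"
    by blast
  also have "\<dots> = {x + (\<alpha> \<cdot>\<^sub>v act g w + \<gamma> \<cdot>\<^sub>v act (pCons 0 g) w) | x \<alpha> \<gamma>. x \<in> K r}"
  proof -
    have "x + \<alpha> \<cdot>\<^sub>v act g w + \<gamma> \<cdot>\<^sub>v act (pCons 0 g) w
        = x + (\<alpha> \<cdot>\<^sub>v act g w + \<gamma> \<cdot>\<^sub>v act (pCons 0 g) w)" if "x \<in> K r" for x \<alpha> \<gamma>
      using K_carrier[OF that] by (intro assoc_add_vec[of _ n]) auto
    then show ?thesis by (intro Collect_cong ex_cong1) auto
  qed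
  finally have sum: "K m = {x + y | x y. x \<in> K r \<and> y \<in> vec_span n {act g w, act (pCons 0 g) w}}"
    unfolding span by blast
  have "x = 0\<^sub>v n" if xK: "x \<in> K r" and xS: "x \<in> vec_span n {act g w, act (pCons 0 g) w}" for x
  proof -
    obtain f where f: "x = act f w" "\<forall>i\<ge>r. coeff f i = 0" using xK by (auto simp: krylov_eq)
    obtain \<alpha> \<gamma> where "x = \<alpha> \<cdot>\<^sub>v act g w + \<gamma> \<cdot>\<^sub>v act (pCons 0 g) w" using xS unfolding span by blast
    then have eq: "act f w = act (smult \<alpha> g + smult \<gamma> (pCons 0 g)) w"
      using f by (simp only: act_add act_smult w_carrier)
    define h where "h = f - (smult \<alpha> g + smult \<gamma> (pCons 0 g))"
    have "act h w = 0\<^sub>v n" unfolding h_def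
      by (subst act_diff) (simp_all only: eq w_carrier minus_cancel_vec[OF act_carrier[OF w_carrier]])
    moreover have "degree h \<le> m"
      unfolding h_def using g f
      by (intro degree_le) (auto simp: m_eq coeff_eq_0 coeff_pCons split: nat.splits)
    ultimately have h0: "h = 0" by (simp add: act_eq_0_iff)
    have "lead_coeff g \<noteq> 0" using g(2) leading_coeff_neq_0 by blast
    have "coeff h (Suc r) = - \<gamma> * lead_coeff g" using f g by (simp add: h_def coeff_eq_0)
    with h0 \<open>lead_coeff g \<noteq> 0\<close> have "\<gamma> = 0" by simp
    then have "coeff h r = - \<alpha> * lead_coeff g" using f g by (simp add: h_def)
    with h0 \<open>lead_coeff g \<noteq> 0\<close> have "\<alpha> = 0" by simp
    with \<open>\<gamma> = 0\<close> h0 have "f = 0" by (simp add: h_def)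
    then show ?thesis using f by simp
  qed
  moreover have "0\<^sub>v n \<in> K r"
    unfolding krylov_eq by (auto intro!: exI[of _ 0])
  moreover have "0\<^sub>v n \<in> vec_span n {act g w, act (pCons 0 g) w}"
  proof -
    have "0\<^sub>v n = 0 \<cdot>\<^sub>v act g w + 0 \<cdot>\<^sub>v act (pCons 0 g) w"
      using zero_smult_vec[OF act_carrier[OF w_carrier]] by simp
    then show ?thesis unfolding span by blast
  qed
  ultimately have "K r \<inter> vec_span n {act g w, act (pCons 0 g) w} = {0\<^sub>v n}" by blast
  with sum show ?thesis unfolding is_direct_sum_def act(2) unfolding act(1) by blast
qed

text \<open>
  If \<open>deg q < r - 1\<close>, then \<open>A q(A) w\<close> lies in \<open>K r\<close>, so a direct sum forces it to vanish, and then
  the extension adds nothing to \<open>K r\<close>.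
\<close>

lemma degree_if_direct_sum:
  assumes q: "degree q \<le> r - 1" and r: "0 < r"
    and direct: "is_direct_sum n (K m) (K r) (vec_span n {A *\<^sub>v act q w, A *\<^sub>v (A *\<^sub>v act q w)})"
  shows "degree q = r - 1"
proof (rule ccontr)
  assume "degree q \<noteq> r - 1"
  then have "\<forall>i\<ge>r. coeff (pCons 0 q) i = 0"
    using q by (auto simp: coeff_pCons coeff_eq_0 split: nat.split)
  then have 1: "A *\<^sub>v act q w \<in> K r" unfolding krylov_eq by (auto simp flip: act_shift)
  have span: "vec_span n {A *\<^sub>v act q w, A *\<^sub>v (A *\<^sub>v act q w)}
      = {\<alpha> \<cdot>\<^sub>v (A *\<^sub>v act q w) + \<gamma> \<cdot>\<^sub>v (A *\<^sub>v (A *\<^sub>v act q w)) | \<alpha> \<gamma>. True}"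
    by (intro vec_span_pair) auto
  have "A *\<^sub>v act q w = 1 \<cdot>\<^sub>v (A *\<^sub>v act q w) + 0 \<cdot>\<^sub>v (A *\<^sub>v (A *\<^sub>v act q w))"
    by (simp add: zero_smult_vec[of _ n])
  then have "A *\<^sub>v act q w \<in> vec_span n {A *\<^sub>v act q w, A *\<^sub>v (A *\<^sub>v act q w)}"
    unfolding span by blast
  with 1 direct have 0: "A *\<^sub>v act q w = 0\<^sub>v n" unfolding is_direct_sum_def by blast
  have "vec_span n {A *\<^sub>v act q w, A *\<^sub>v (A *\<^sub>v act q w)} = {0\<^sub>v n}"
  proof -
    have "\<alpha> \<cdot>\<^sub>v 0\<^sub>v n = (0\<^sub>v n :: complex vec)" for \<alpha> by (intro eq_vecI) auto
    then show ?thesis by (subst vec_span_pair) (auto simp: 0 mult_mat_vec_zero[OF A_carrier])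
  qed
  then have "K m \<subseteq> K r"
    using direct K_carrier[of _ r] by (fastforce simp: is_direct_sum_def)
  then have "e r \<in> K r" using e_in_K[of r m] by auto
  then have "ip M (e r) (e r) = 0" by (intro K_orthogonal) auto
  then show False by (simp add: ip_e)
qed

section \<open>Change from the Lanczos basis to the extended basis\<close>

abbreviation V :: "complex mat" where "V \<equiv> lanczos_basis n A w p m"

text \<open>The last two columns of \<open>Y\<close> are Lanczos vectors, which gives the identity
  block. The columns of \<open>U\<close> lie in \<open>K r\<close>, the span of the first
  \<open>r\<close> Lanczos vectors, which gives the zero blocks.\<close>

lemma gram_V_Y:
  "gram M V Y = four_block_mat (gram M (lanczos_basis n A w p r) U) (0\<^sub>m r 2) (0\<^sub>m 2 r) (1\<^sub>m 2)"
  (is "_ = ?B")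
proof (rule eq_matI)
  have L: "lanczos_basis n A w p r \<in> carrier_mat n r" and Vc: "V \<in> carrier_mat n (Suc (Suc r))"
    using lanczos_basis_carrier[of m] by (simp_all add: m_eq)
  have dims: "dim_row (gram M (lanczos_basis n A w p r) U) = r"
      "dim_col (gram M (lanczos_basis n A w p r) U) = r"
    using carrier_matD[OF L] carrier_matD[OF U(1)] by auto
  fix i j assume "i < dim_row ?B" "j < dim_col ?B"
  then have ij: "i < Suc (Suc r)" "j < Suc (Suc r)" using dims by auto
  have "gram M V Y $$ (i, j) = ip M (e i) (if j < r then col U j else e j)"
    using ij by (subst gram_index[OF M_carrier Vc Y_carrier]) (auto simp: col_Y col_lanczos_basis m_eq)
  also have "\<dots> = ?B $$ (i, j)"
    using ij dims K_orthogonal_right[OF col_U_K, of j i]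
    by (auto simp: gram_index[OF M_carrier L U(1)] col_lanczos_basis ip_e m_eq)
  finally show "gram M V Y $$ (i, j) = ?B $$ (i, j)" .
qed (use carrier_matD[OF lanczos_basis_carrier] carrier_matD[OF Y_carrier] carrier_matD[OF U(1)] m_eq in auto)

text \<open>Each column of \<open>Y\<close> lies in the range of \<open>V\<close> and is therefore
  fixed by the projection onto it. So \<open>gram M V Y\<close> is the matrix of the basis
  change.\<close>

lemma V_gram: "V * gram M V Y = Y"
proof (rule mat_col_eqI)
  have Vc: "V \<in> carrier_mat n m" by simp
  have Yc: "Y \<in> carrier_mat n m" by (simp add: m_eq)
  have Gc: "gram M V Y \<in> carrier_mat m m" by (rule gram_carrier[OF Vc Yc])
  fix j assume "j < dim_col Y"
  then have j: "j < m" using carrier_matD[OF Yc] by simp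
  have cY: "col Y j \<in> carrier_vec n" using Yc j by auto
  have "col (gram M V Y) j = gram_vec M V (col Y j)"
    using j carrier_matD[OF Yc] carrier_matD[OF Vc] gram_index[OF M_carrier Vc Yc]
      gram_vec_index[OF M_carrier Vc cY] carrier_matD[OF Y_carrier]
    by (intro eq_vecI) (simp_all add: col_dim)
  moreover have "col Y j \<in> vec_space.col_space n V"
  proof -
    have "col Y j = Y *\<^sub>v unit_vec m j" using mult_unit_vec[OF Yc j] by simp
    then have "col Y j \<in> vec_space.col_space n Y"
      unfolding col_space_eq_image[OF Yc] by auto
    then show ?thesis by (simp add: Y_space col_space_lanczos_basis m_eq)
  qed
  ultimately show "col (V * gram M V Y) j = col Y j"
    using project_col_space[OF M_carrier Vc gram_lanczos_basis] j by (simp add: col_mult2[OF Vc Gc])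
qed (use carrier_matD[OF lanczos_basis_carrier] carrier_matD[OF Y_carrier] in auto)

lemma jacobi_index:
  assumes "i < m" "j < m"
  shows "gram M V (A * V) $$ (i, j) = ip M (e i) (A *\<^sub>v e j)"
proof -
  have Vc: "V \<in> carrier_mat n m" by simp
  show ?thesis
    using assms
    by (simp add: gram_index[OF M_carrier Vc mult_carrier_mat[OF A_carrier Vc]]
      col_mult2[OF A_carrier Vc] col_lanczos_basis)
qed

text \<open>Both outer factors can be pulled into the Gram matrix, where each turns \<open>V\<close>
  into \<open>Y\<close>.\<close>

lemma transformed_jacobi:
  "mat_adjoint (gram M V Y) * gram M V (A * V) * gram M V Y = gram M Y (A * Y)"
proof -
  let ?K = "gram M V Y"
  have Vc: "V \<in> carrier_mat n m" and Yc: "Y \<in> carrier_mat n m" by (simp_all add: m_eq)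
  then have Kc: "?K \<in> carrier_mat m m" by (rule gram_carrier)
  have AV: "A * V \<in> carrier_mat n m" by (rule mult_carrier_mat[OF A_carrier Vc])
  have "mat_adjoint ?K * gram M V (A * V) = gram M Y (A * V)"
    using gram_mult_left[OF M_carrier Vc AV Kc] by (simp add: V_gram)
  then have "mat_adjoint ?K * gram M V (A * V) * ?K = gram M Y (A * V) * ?K" by simp
  also have "\<dots> = gram M Y (A * V * ?K)"
    by (rule gram_mult_right[OF M_carrier Yc AV Kc, symmetric])
  also have "A * V * ?K = A * Y"
    by (simp add: assoc_mult_mat[OF A_carrier Vc Kc] V_gram)
  finally show ?thesis .
qed

text \<open>The modified matrix is the Jacobi matrix plus \<open>D\<close>, which has a single entry
  in the last corner. The last row of the basis change is a unit row, so \<open>D\<close> is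
  unaffected by it and only changes the corner of the bordered matrix.\<close>

lemma transformed_qor:
  "mat_adjoint (gram M V Y) * (gram M V (A * V) |\<^sub>m (m - 1, m - 1) \<mapsto> d) * gram M V Y
    = bordered_mat G (complex_of_real (b (Suc r)) \<cdot>\<^sub>v unit_vec (Suc r) r) d"
proof -
  let ?K = "gram M V Y" and ?J = "gram M V (A * V)" and ?x = "complex_of_real (b (Suc r)) \<cdot>\<^sub>v unit_vec (Suc r) r"
  define \<delta> where "\<delta> = d - complex_of_real (a m)"
  define D where "D = mat m m (\<lambda>(i, j). if i = m - 1 \<and> j = m - 1 then \<delta> else 0)"
  have Vc: "V \<in> carrier_mat n m" and Yc: "Y \<in> carrier_mat n m" by (simp_all add: m_eq)
  have L: "lanczos_basis n A w p r \<in> carrier_mat n r" by simp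
  have Kc: "?K \<in> carrier_mat m m" by (rule gram_carrier[OF Vc Yc])
  then have K': "mat_adjoint ?K \<in> carrier_mat m m" by (rule mat_adjoint_carrier)
  have Jc: "?J \<in> carrier_mat m m" using mult_carrier_mat[OF A_carrier Vc] Vc by blast
  have Dc: "D \<in> carrier_mat m m" by (simp add: D_def)
  have last: "?K $$ (m - 1, j) = (if j = m - 1 then 1 else 0)" if "j < m" for j
    using that carrier_matD[OF gram_carrier[OF L U(1), of M]] unfolding gram_V_Y
    by (auto simp: m_eq simp del: dim_gram)
  have "?J |\<^sub>m (m - 1, m - 1) \<mapsto> d = ?J + D"
    using carrier_matD[OF Jc] m_bounds jacobi_index[of "m - 1" "m - 1"]
    by (intro eq_matI) (auto simp: D_def \<delta>_def m_eq ip_A_e)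
  then have "mat_adjoint ?K * (?J |\<^sub>m (m - 1, m - 1) \<mapsto> d) * ?K
      = mat_adjoint ?K * ?J * ?K + mat_adjoint ?K * D * ?K"
    using Jc Dc Kc K' by (simp add: mult_add_distrib_mat[of _ m m _ m] add_mult_distrib_mat[of _ m m _ _ m]
      mult_carrier_mat[of _ m m _ m])
  also have "mat_adjoint ?K * D = D"
  proof (rule eq_matI)
    fix i j assume "i < dim_row D" "j < dim_col D"
    then have ij: "i < m" "j < m" using Dc by auto
    have "(mat_adjoint ?K * D) $$ (i, j) = (\<Sum>l<m. cnj (?K $$ (l, i)) * D $$ (l, j))"
      using ij carrier_matD[OF Kc] carrier_matD[OF Dc]
      by (auto simp: scalar_prod_def lessThan_atLeast0 intro!: sum.cong)
    also have "\<dots> = (\<Sum>l<m. if l = m - 1 then cnj (?K $$ (l, i)) * D $$ (l, j) else 0)"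
      using ij by (intro sum.cong) (auto simp: D_def)
    also have "\<dots> = D $$ (i, j)"
      using ij m_bounds last[OF ij(1)] by (auto simp: D_def)
    finally show "(mat_adjoint ?K * D) $$ (i, j) = D $$ (i, j)" .
  qed (use Dc Kc in auto)
  also have "D * ?K = D"
  proof (rule eq_matI)
    fix i j assume "i < dim_row D" "j < dim_col D"
    then have ij: "i < m" "j < m" using Dc by auto
    have "(D * ?K) $$ (i, j) = (\<Sum>l<m. D $$ (i, l) * ?K $$ (l, j))"
      using ij carrier_matD[OF Kc] carrier_matD[OF Dc]
      by (auto simp: scalar_prod_def lessThan_atLeast0 intro!: sum.cong)
    also have "\<dots> = (\<Sum>l<m. if l = m - 1 then D $$ (i, l) * ?K $$ (l, j) else 0)"
      using ij by (intro sum.cong) (auto simp: D_def)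
    also have "\<dots> = D $$ (i, j)"
      using ij m_bounds last[OF ij(2)] by (auto simp: D_def)
    finally show "(D * ?K) $$ (i, j) = D $$ (i, j)" .
  qed (use Dc Kc in auto)
  also have "mat_adjoint ?K * ?J * ?K = bordered_mat G ?x (complex_of_real (a m))"
    by (simp add: transformed_jacobi gram_Y)
  also have "bordered_mat G ?x (complex_of_real (a m)) + D = bordered_mat G ?x d"
  proof -
    have xc: "?x \<in> carrier_vec (Suc r)" by simp
    have B: "bordered_mat G ?x c \<in> carrier_mat m m" for c
      using bordered_mat_carrier[OF G_carrier xc] by (simp add: m_eq)
    show ?thesis
      using carrier_matD[OF B] carrier_matD[OF Dc]
      by (intro eq_matI) (auto simp: bordered_mat_index[OF G_carrier xc] D_def m_eq \<delta>_def)
  qed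
  finally show ?thesis .
qed

section \<open>The corner entry of the inverse of the shifted Rayleigh quotient\<close>

lemma G_shift_invertible:
  assumes \<xi>: "poly (P (Suc r)) \<xi> \<noteq> 0"
  shows "invertible_mat (G - \<xi> \<cdot>\<^sub>m 1\<^sub>m (Suc r))"
    and "complex_of_real (b (Suc r)) *
      ((mat_inv (G - \<xi> \<cdot>\<^sub>m 1\<^sub>m (Suc r)) *\<^sub>v unit_vec (Suc r) r) \<bullet>c unit_vec (Suc r) r)
      = - poly (P r) \<xi> / poly (P (Suc r)) \<xi>"
proof -
  let ?B = "G - \<xi> \<cdot>\<^sub>m 1\<^sub>m (Suc r)" and ?e = "unit_vec (Suc r) r :: complex vec"
  have Bc: "?B \<in> carrier_mat (Suc r) (Suc r)"
    by (intro minus_carrier_mat smult_carrier_mat) simp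
  have B: "G *\<^sub>v y = \<xi> \<cdot>\<^sub>v y + ?B *\<^sub>v y" if y: "y \<in> carrier_vec (Suc r)" for y
  proof -
    have "?B *\<^sub>v y = G *\<^sub>v y - \<xi> \<cdot>\<^sub>v y"
      using y by (subst minus_mult_distrib_mat_vec[of _ "Suc r" "Suc r"])
        (simp_all add: smult_mat_mult_vec[of _ "Suc r" "Suc r"])
    then show ?thesis using y carrier_vecD[OF mult_mat_vec_carrier[OF G_carrier y]]
      by (intro eq_vecI) simp_all
  qed
  show inv: "invertible_mat ?B"
  proof (rule invertible_mat_if_trivial_kernel[OF Bc])
    fix y assume y: "y \<in> carrier_vec (Suc r)" "?B *\<^sub>v y = 0\<^sub>v (Suc r)"
    \<comment> \<open>A kernel vector is the case \<open>\<delta> = 0\<close> of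
      \<open>G_shifted\<close>.\<close>
    then have "G *\<^sub>v y = \<xi> \<cdot>\<^sub>v y + 0 \<cdot>\<^sub>v ?e" using B[OF y(1)] by (simp add: zero_smult_vec[of _ "Suc r"])
    then show "y = 0\<^sub>v (Suc r)" using G_shifted(2)[OF y(1) _ \<xi>] by blast
  qed
  note I = mat_inv_right[OF Bc inv]
  define y where "y = mat_inv ?B *\<^sub>v ?e"
  have y: "y \<in> carrier_vec (Suc r)" unfolding y_def by (rule mult_mat_vec_carrier[OF I(1)]) simp
  have "?B *\<^sub>v y = ?e"
    unfolding y_def by (subst assoc_mult_mat_vec[OF Bc I(1), symmetric]) (simp_all add: I(2))
  \<comment> \<open>The last column of the inverse is the case \<open>\<delta> = 1\<close>; its last
    coordinate is the required entry.\<close>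
  then have "G *\<^sub>v y = \<xi> \<cdot>\<^sub>v y + 1 \<cdot>\<^sub>v ?e" using B[OF y] by simp
  then have "complex_of_real (b (Suc r)) * y $ r = - poly (P r) \<xi> / poly (P (Suc r)) \<xi>"
    using G_shifted(1)[OF y _ \<xi>] by fastforce
  moreover have "conjugate ?e = ?e" by (intro eq_vecI) (auto simp: unit_vec_def)
  ultimately show "complex_of_real (b (Suc r)) *
      ((mat_inv ?B *\<^sub>v ?e) \<bullet>c ?e) = - poly (P r) \<xi> / poly (P (Suc r)) \<xi>"
    using y by (simp flip: y_def)
qed

end

section \<open>The denominator polynomial\<close>

lemma denominator_Nil [simp]: "denominator [] = 1"
  by (simp add: denominator_def)

lemma denominator_Cons [simp]:
  "denominator (x # s) = (case x of Finite z \<Rightarrow> [:- z, 1:] * denominator s | _ \<Rightarrow> denominator s)"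
  by (simp add: denominator_def split: pole.split)

text \<open>Infinite poles contribute no factor, and every other factor is monic. This fixes the
  sign in the orthogonalization of \<open>A u\<close>.\<close>

lemma denominator_monic: "lead_coeff (denominator s) = 1"
  by (induction s) (auto simp: lead_coeff_mult simp del: mult_pCons_left split: pole.split)

lemma denominator_nonzero [simp]: "denominator s \<noteq> 0"
  using denominator_monic[of s] by auto

lemma degree_denominator_le: "degree (denominator s) \<le> length s"
  by (induction s) (auto simp: degree_mult_eq simp del: mult_pCons_left split: pole.split)

lemma degree_denominator:
  "\<forall>x\<in>set s. \<exists>z. x = Finite z \<Longrightarrow> degree (denominator s) = length s"
  by (induction s) (auto simp: degree_mult_eq simp del: mult_pCons_left)

text \<open>The factors are removed one at a time: a nonzero vector annihilated by the factor of a
  finite pole \<open>z\<close> would be an eigenvector for \<open>z\<close>.\<close>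

lemma (in matrix_action) act_denominator_eq_0:
  assumes "\<forall>z. Finite z \<in> set s \<longrightarrow> \<not> eigenvalue A z" "x \<in> carrier_vec n"
    and "act (denominator s) x = 0\<^sub>v n"
  shows "x = 0\<^sub>v n"
  using assms
proof (induction s)
  case (Cons t s)
  have "act (denominator s) x = 0\<^sub>v n"
  proof (cases t)
    case (Finite z)
    let ?y = "act (denominator s) x"
    have y: "?y \<in> carrier_vec n" using Cons.prems by simp
    have "0\<^sub>v n = act [:- z, 1:] ?y"
      using Cons.prems Finite by (simp only: denominator_Cons pole.case act_mult)
    also have "\<dots> = - z \<cdot>\<^sub>v ?y + A *\<^sub>v ?y" using y by (simp add: act_pCons mult_mat_vec_zero[OF A_carrier])
    finally have eq: "- z \<cdot>\<^sub>v ?y + A *\<^sub>v ?y = 0\<^sub>v n" ..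
    have "A *\<^sub>v ?y = z \<cdot>\<^sub>v ?y"
    proof (rule eq_vecI)
      fix i assume "i < dim_vec (z \<cdot>\<^sub>v ?y)"
      then have i: "i < n" using y by simp
      then have "(- z \<cdot>\<^sub>v ?y + A *\<^sub>v ?y) $ i = 0" using eq by simp
      then show "(A *\<^sub>v ?y) $ i = (z \<cdot>\<^sub>v ?y) $ i"
        using i y carrier_matD[OF A_carrier] by simp
    qed (use y carrier_matD[OF A_carrier] in simp)
    moreover have "\<not> eigenvalue A z" using Cons.prems Finite by simp
    ultimately show ?thesis
      using y carrier_matD[OF A_carrier] unfolding eigenvalue_def eigenvector_def by auto
  qed (use Cons.prems in auto)
  then show ?case using Cons by auto
qed simp

section \<open>The extended Krylov subspace for given poles\<close>

theorem proposition3p7: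
  fixes n m :: nat
    and M A W U Vm Jm Um Am Am1 Am2 Km Km2 Tm Bm :: "complex mat"
    and u uq c vm1 vm at_vec em1 :: "complex vec"
    and s :: "pole list"
    and q :: "complex poly"
    and p :: "nat \<Rightarrow> real poly"
    and a \<beta> :: "nat \<Rightarrow> real"
    and \<xi> \<omega> :: real
  assumes M: "hermitian_pos_def n M"
    and A: "self_adjoint_wrt n M A"
    and distinct_eigenvalues: "card {\<mu>. eigenvalue A \<mu>} = n"
    and m: "3 \<le> m" "m < n"
    \<comment> \<open>starting vector: nonzero coefficients \<open>c\<close> in the eigenbasis \<open>W\<close>\<close>
    and W: "orthonormal_eigenbasis n M A W"
    and c: "c \<in> carrier_vec n" "\<forall>j<n. c $ j \<noteq> 0"
    and u: "u = W *\<^sub>v c"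
    \<comment> \<open>poles\<close>
    and s: "length s = m - 3" "\<forall>z. Finite z \<in> set s \<longrightarrow> \<not> eigenvalue A z"
    and q: "q = denominator s"
    and uq: "uq = mat_inv (poly_mat q A) *\<^sub>v u"
    \<comment> \<open>given orthonormal basis of the rational Krylov subspace\<close>
    and U: "U \<in> carrier_mat n (m - 2)" "gram M U U = 1\<^sub>m (m - 2)"
      "vec_space.col_space n U = rational_krylov (m - 2) q A u"
    and Am2: "Am2 = gram M U (A * U)"
    \<comment> \<open>Lanczos basis and Jacobi matrix\<close>
    and lanczos: "lanczos_data M A uq m p a \<beta>"
    and Vm: "Vm = lanczos_basis n A uq p m"
    and Jm: "Jm = gram M Vm (A * Vm)"
    and vm1: "vm1 = lanczos_vec A uq p (m - 1)"
    and vm: "vm = lanczos_vec A uq p m"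
    \<comment> \<open>quantities of the extended subspace\<close>
    and Um: "Um = append_cols U [vm1, vm]"
    and Am: "Am = gram M Um (A * Um)"
    and at_vec: "at_vec = gram_vec M U (A *\<^sub>v vm1)"
    and Am1: "Am1 = bordered_mat Am2 at_vec (complex_of_real (a (m - 1)))"
    and em1: "em1 = unit_vec (m - 1) (m - 2)"
    and Km: "Km = gram M Vm Um"
    and Km2: "Km2 = gram M (lanczos_basis n A uq p (m - 2)) U"
    \<comment> \<open>qor-Krylov matrix and representation\<close>
    and \<xi>: "poly (p (m - 1)) \<xi> \<noteq> 0"
    and \<omega>: "\<omega> = \<xi> - \<beta> (m - 1) * poly (p (m - 2)) \<xi> / poly (p (m - 1)) \<xi>"
    and Tm: "Tm = Jm |\<^sub>m (m - 1, m - 1) \<mapsto> complex_of_real \<omega>"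
    and Bm: "Bm = mat_adjoint Km * Tm * Km"
  shows
    \<comment> \<open>the setting is well defined\<close>
    "invertible_mat (poly_mat q A)
     \<and> rational_krylov (m - 2) q A u = krylov n (m - 2) A uq
     \<and> ((\<forall>x\<in>set s. \<exists>z. x = Finite z) \<longrightarrow>
          is_direct_sum n (krylov n m A uq) (rational_krylov (m - 2) q A u)
            (vec_span n {A *\<^sub>v u, A *\<^sub>v (A *\<^sub>v u)}))
     \<comment> \<open>(i)\<close>
     \<and> Um \<in> carrier_mat n m \<and> gram M Um Um = 1\<^sub>m m
     \<and> vec_space.col_space n Um = krylov n m A uq
     \<comment> \<open>(i) and (ii): computation from \<open>M\<close>, \<open>A\<close>, \<open>u\<close>, \<open>U\<close>, without reference to \<open>uq\<close>\<close>
     \<and> (is_direct_sum n (krylov n m A uq) (rational_krylov (m - 2) q A u)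
            (vec_span n {A *\<^sub>v u, A *\<^sub>v (A *\<^sub>v u)}) \<longrightarrow>
          extend_orthonormal_basis M A u U =
            (vm1, vm, at_vec @\<^sub>v vec 1 (\<lambda>_. complex_of_real (a (m - 1))),
             \<beta> (m - 1), complex_of_real (a m)))
     \<comment> \<open>(ii)\<close>
     \<and> Am1 \<in> carrier_mat (m - 1) (m - 1)
     \<and> Am = bordered_mat Am1 (complex_of_real (\<beta> (m - 1)) \<cdot>\<^sub>v em1) (complex_of_real (a m))
     \<and> complex_of_real (a m) = Jm $$ (m - 1, m - 1)
     \<and> complex_of_real (a (m - 1)) = Jm $$ (m - 2, m - 2)
     \<and> complex_of_real (\<beta> (m - 1)) = Jm $$ (m - 1, m - 2)
     \<comment> \<open>(iii)\<close>
     \<and> Km = four_block_mat Km2 (0\<^sub>m (m - 2) 2) (0\<^sub>m 2 (m - 2)) (1\<^sub>m 2)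
     \<comment> \<open>(iv)\<close>
     \<and> Bm = bordered_mat Am1 (complex_of_real (\<beta> (m - 1)) \<cdot>\<^sub>v em1) (complex_of_real \<omega>)
     \<and> invertible_mat (Am1 - complex_of_real \<xi> \<cdot>\<^sub>m 1\<^sub>m (m - 1))
     \<and> complex_of_real \<omega> = complex_of_real \<xi> + (complex_of_real (\<beta> (m - 1)))\<^sup>2 *
         ((mat_inv (Am1 - complex_of_real \<xi> \<cdot>\<^sub>m 1\<^sub>m (m - 1)) *\<^sub>v em1) \<bullet>c em1)"
proof -
  define r where "r = m - 2"
  have m_eq: "m = Suc (Suc r)" and r: "0 < r" and idx: "m - 1 = Suc r" "m - Suc 0 = Suc r" "m - 2 = r"
    using m by (auto simp: r_def)
  have Mc: "M \<in> carrier_mat n n" using M by (simp add: hermitian_pos_def_def)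
  interpret matrix_action n A
    using A by unfold_locales (simp add: self_adjoint_wrt_def)
  have uc: "u \<in> carrier_vec n"
    unfolding u using W c(1) by (auto simp: orthonormal_eigenbasis_def intro: mult_mat_vec_carrier)
  have qc: "poly_mat q A \<in> carrier_mat n n" by simp
  have inv: "invertible_mat (poly_mat q A)"
    using act_denominator_eq_0[OF s(2)] unfolding act_def q
    by (intro invertible_mat_if_trivial_kernel[of _ n]) auto
  note qinv = mat_inv_right[OF qc inv]
  have uqc: "uq \<in> carrier_vec n" unfolding uq using qinv(1) uc by (rule mult_mat_vec_carrier)
  interpret lanczos_process n A uq M m p a \<beta>
    using M A lanczos uqc by unfold_locales
  \<comment> \<open>Applying \<open>q\<close> recovers \<open>u\<close> from \<open>uq\<close>, so
    \<open>A u\<close> is \<lambda>q acting on \<open>uq\<close>.\<close>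
  have act_q: "act q uq = u"
    unfolding act_def uq using assoc_mult_mat_vec[OF qc qinv(1) uc] uc by (simp add: qinv(2))
  \<comment> \<open>The subtraction is harmless because \<open>r\<close> is positive; for
    \<open>r = 0\<close> the left side would still admit constants.\<close>
  have "degree f \<le> r - 1 \<longleftrightarrow> (\<forall>i\<ge>r. coeff f i = 0)" for f :: "complex poly"
    using r by (auto simp: coeff_eq_0 intro: degree_le)
  then have rational: "rational_krylov r q A u = K r"
    unfolding rational_krylov_def krylov_eq by (simp add: act_def uq)
  interpret krylov_extension n A uq M m p a \<beta> U r
    using U m_eq rational unfolding idx by unfold_locales auto
  have v: "vm1 = e r" "vm = e (Suc r)"
    by (simp_all add: vm1 vm lanczos_vec_eq m_eq)
  have Um_eq: "Um = Y"
    unfolding Um Y_def X_def v using U(1) by (subst append_cols_append) auto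
  have Am1_eq: "Am1 = G"
    by (simp add: Am1 G_eq Am2 at_vec v m_eq)
  have em1_eq: "em1 = unit_vec (Suc r) r" by (simp add: em1 m_eq)
  have Jm_index: "Jm $$ (i, j) = ip M (e i) (A *\<^sub>v e j)" if "i < m" "j < m" for i j
    using jacobi_index[OF that] by (simp add: Jm Vm)
  have deg: "degree q \<le> r - 1" "lead_coeff q = 1" "q \<noteq> 0"
    using degree_denominator_le[of s] s(1) m_eq denominator_monic[of s] by (auto simp: q)
  have direct: "is_direct_sum n (krylov n m A uq) (rational_krylov (m - 2) q A u)
      (vec_span n {A *\<^sub>v u, A *\<^sub>v (A *\<^sub>v u)})" if "\<forall>x\<in>set s. \<exists>z. x = Finite z"
  proof -
    have "degree q = r - 1" using degree_denominator[OF that] s(1) m_eq by (simp add: q)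
    then show ?thesis
      using krylov_direct_sum[OF _ deg(3) r] by (simp add: idx rational act_q)
  qed
  have extend: "extend_orthonormal_basis M A u U =
      (vm1, vm, at_vec @\<^sub>v vec 1 (\<lambda>_. complex_of_real (a (m - 1))), \<beta> (m - 1), complex_of_real (a m))"
    if "is_direct_sum n (krylov n m A uq) (rational_krylov (m - 2) q A u)
      (vec_span n {A *\<^sub>v u, A *\<^sub>v (A *\<^sub>v u)})"
  proof -
    \<comment> \<open>Directness is the only information here about the number of finite poles, and
      it forces the full degree.\<close>
    have "degree q = r - 1"
      using that by (intro degree_if_direct_sum[OF deg(1) r]) (simp add: idx rational act_q)
    then show ?thesis
      using extend_orthonormal_basis_eq[OF _ deg(2) r] by (simp add: act_q v idx at_vec)
  qed
  have P_of_real: "poly (P j) (complex_of_real \<xi>) = complex_of_real (poly (p j) \<xi>)" for j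
    by (simp add: P_def)
  have P\<xi>: "poly (P (Suc r)) (complex_of_real \<xi>) \<noteq> 0"
    using \<xi> by (simp add: P_of_real idx)
  note shift = G_shift_invertible[OF P\<xi>]
  let ?z = "(mat_inv (Am1 - complex_of_real \<xi> \<cdot>\<^sub>m 1\<^sub>m (m - 1)) *\<^sub>v em1) \<bullet>c em1"
  have z: "complex_of_real (\<beta> (Suc r)) * ?z
      = - complex_of_real (poly (p r) \<xi> / poly (p (Suc r)) \<xi>)"
    using shift(2) by (simp add: Am1_eq em1_eq idx P_of_real)
  \<comment> \<open>One factor of the square is absorbed by the formula \<open>z\<close>; the other
    is the factor in the definition of \<open>\<omega>\<close>.\<close>
  have "(complex_of_real (\<beta> (m - 1)))\<^sup>2 * ?z
      = complex_of_real (\<beta> (Suc r)) * (complex_of_real (\<beta> (Suc r)) * ?z)"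
    by (simp add: idx power2_eq_square)
  then have \<omega>_eq: "complex_of_real \<omega> = complex_of_real \<xi> + (complex_of_real (\<beta> (m - 1)))\<^sup>2 * ?z"
    unfolding z by (simp add: \<omega> idx)
  have Am_eq: "Am = bordered_mat Am1 (complex_of_real (\<beta> (m - 1)) \<cdot>\<^sub>v em1) (complex_of_real (a m))"
    using gram_Y by (simp add: Am Um_eq Am1_eq em1_eq idx)
  have Km_eq: "Km = four_block_mat Km2 (0\<^sub>m (m - 2) 2) (0\<^sub>m 2 (m - 2)) (1\<^sub>m 2)"
    using gram_V_Y by (simp add: Km Vm Um_eq Km2 idx)
  have Bm_eq: "Bm = bordered_mat Am1 (complex_of_real (\<beta> (m - 1)) \<cdot>\<^sub>v em1) (complex_of_real \<omega>)"
    using transformed_qor by (simp add: Bm Tm Jm Km Vm Um_eq Am1_eq em1_eq idx)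
  show ?thesis
  proof (intro conjI impI)
    show "rational_krylov (m - 2) q A u = krylov n (m - 2) A uq" by (simp add: idx rational)
    show "Um \<in> carrier_mat n m" using Y_carrier by (simp add: Um_eq m_eq)
    show "gram M Um Um = 1\<^sub>m m" using Y_one by (simp add: Um_eq m_eq)
    show "vec_space.col_space n Um = krylov n m A uq" using Y_space by (simp add: Um_eq m_eq)
    show "Am1 \<in> carrier_mat (m - 1) (m - 1)" by (simp add: Am1_eq idx)
    show "invertible_mat (Am1 - complex_of_real \<xi> \<cdot>\<^sub>m 1\<^sub>m (m - 1))"
      using shift(1) by (simp add: Am1_eq idx)
    show "complex_of_real (a m) = Jm $$ (m - 1, m - 1)"
      "complex_of_real (a (m - 1)) = Jm $$ (m - 2, m - 2)"
      "complex_of_real (\<beta> (m - 1)) = Jm $$ (m - 1, m - 2)"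
      by (simp_all add: Jm_index ip_A_e m_eq)
  qed (fact inv direct extend Am_eq Km_eq Bm_eq \<omega>_eq)+
qed

end
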